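(* \[ \mu_2(1+x+y+z) = \frac{12}{\pi^2}\,\lambda_4\!\left(\tfrac12\right) - \frac{\pi^2}{5}. \]
   Context: For a Laurent polynomial $P$ in $n$ variables, the higher Mahler measure is $\mu_k(P) := \int_0^1\cdots\int_0^1 \log^k\left|P\left(e^{2\pi i t_1},\ldots,e^{2\pi i t_n}\right)\right|\mathrm{d}t_1\cdots\mathrm{d}t_n$; here $k=2$ and $P=1+x+y+z$ in three variables. For $n\ge2$, $\lambda_n(x) := (n-2)!\sum_{k=0}^{n-2}\frac{(-1)^k}{k!}\mathrm{Li}_{n-k}(x)\log^k|x| + \frac{(-1)^n}{n}\log^n|x|$, where $\mathrm{Li}_m(x)=\sum_{j\ge1}x^j/j^m$ is the polylogarithm. *)

theory Defs
  imports "HOL-Analysis.Analysis"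
begin

definition polylog :: "nat \<Rightarrow> real \<Rightarrow> real" where
  "polylog m x = (\<Sum>j. x ^ Suc j / (real (Suc j)) ^ m)"

definition lambda_fn :: "nat \<Rightarrow> real \<Rightarrow> real" where
  "lambda_fn n x =
     fact (n - 2) * (\<Sum>k=0..n-2. ((-1) ^ k / fact k) * polylog (n - k) x * (ln \<bar>x\<bar>) ^ k)
     + ((-1) ^ n / real n) * (ln \<bar>x\<bar>) ^ n"

text \<open>Higher Mahler measure mu_k of a Laurent polynomial P in three variables,
  given as a function on (C^*)^3: integral over the unit cube [0,1]^3 of log^k |P(e^{2 pi i t})|.\<close>
definition higher_mahler3 :: "nat \<Rightarrow> (complex \<Rightarrow> complex \<Rightarrow> complex \<Rightarrow> complex) \<Rightarrow> real" where
  "higher_mahler3 k P =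
     (LINT t : {0..1::real} \<times> {0..1::real} \<times> {0..1::real} | lborel.
        (ln (cmod (P (cis (2 * pi * fst t)) (cis (2 * pi * fst (snd t))) (cis (2 * pi * snd (snd t)))))) ^ k)"

end

theory Submission
  imports Defs "HOL-Real_Asymp.Real_Asymp"
begin

text \<open>
  After the shift z = y w the factor y multiplies 1 + w, and 1 + x and 1 + w have moduli
  2 sin a and 2 sin b with a, b uniform on [0, pi/2]. Parseval applied to
  ln |1 + r e(t)| gives the mean of (ln |A + B e(t)|)^2 over the circle as
  (ln A)^2 + Li_2 ((B/A)^2) / 2 for A > B, so by symmetry
  pi^2 mu_2 = 8 I + 4 J, where I is the integral of a (ln (2 sin a))^2 over [0, pi/2] and
  J the integral of Li_2 ((sin b / sin a)^2) over 0 < b < a < pi/2.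

  With H the harmonic numbers and U the sum of H_(n-1) / n^3 over odd n, the real part of
  (Ln (1 - z))^2 = 2 sum H_(n-1) z^n / n on the unit circle gives I = pi^4/192 - U. Expanding
  Li_2, a reduction formula for the integral of sin^(2n) gives J = sum O_n / (2 n^3) with
  O_n = 1 + 1/3 + ... + 1/(2n-1), hence J = 15/4 zeta(3,1) - 4 U. Finally
  2 U = zeta(3,1) - sum (-1)^n H_(n-1) / n^3, and the alternating sum is reduced to
  lambda_4 (1/2), zeta(4) and zeta(3,1) = zeta(4) / 4 by exhibiting a combination of
  polylogarithms with zero derivative.
\<close>

section \<open>Double zeta values of weight four\<close>

text \<open>The logarithm is unbounded near the zeros of 1 + x + y + z, so everything over the cube
  is done with nonnegative integrals: Tonelli, the shift and termwise summation then require no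
  integrability, and integrability of the integrand follows from the finite value. Put V = - sum
  (-1)^n H_(n-1) / n^3, so that U = (zeta(3,1) + V) / 2. Both I and J are affine in V, and 8 I + 4 J
  = pi^4/24 + 3 zeta(3,1) - 12 V; the whole difficulty is thus concentrated in V, the negative of
  the value at -1 of S(x) = sum H_(n-1) x^n / n^3. The map x -> 1 - 1/x carries 1/2 to -1, and
  following S along it expresses S(-1) by lambda_4 (1/2) together with values of harmonic series at
  1/2. These last values are not individually elementary, but the one combination that occurs is
  fixed by the reflection x -> 1 - x.\<close>

lemma summable_inverse_powers: "m \<ge> 2 \<Longrightarrow> summable (\<lambda>i. 1 / real (Suc i) ^ m)"
  using inverse_power_summable[where 'a = real, of m]
  by (subst summable_Suc_iff) (simp add: field_simps)

lemma zeta2_has_sum: "((\<lambda>i. 1 / real (Suc i) ^ 2) has_sum (pi\<^sup>2 / 6)) UNIV"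
  using inverse_squares_sums by (intro sums_nonneg_imp_has_sum) (auto simp: add_ac)

text \<open>The square of zeta(2) as an unordered double sum. Besides its value, it serves as the
  majorant that makes the two double zeta sums summable.\<close>

lemma grid_has_sum:
  "((\<lambda>(i, j). 1 / (real (Suc i) ^ 2 * real (Suc j) ^ 2)) has_sum (pi\<^sup>2 / 6)\<^sup>2) UNIV"
proof -
  let ?f = "\<lambda>i. 1 / real (Suc i) ^ 2"
  have s: "((\<lambda>j. ?f i * ?f j) has_sum (?f i * (pi\<^sup>2 / 6))) UNIV" for i
    by (intro has_sum_cmult_right zeta2_has_sum)
  have "((\<lambda>i. ?f i * (pi\<^sup>2 / 6)) has_sum ((pi\<^sup>2 / 6) * (pi\<^sup>2 / 6))) UNIV"
    by (intro has_sum_cmult_left zeta2_has_sum)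
  then have "((\<lambda>(i, j). ?f i * ?f j) has_sum ((pi\<^sup>2 / 6) * (pi\<^sup>2 / 6))) (Sigma UNIV (\<lambda>_. UNIV))"
    by (intro has_sum_SigmaI summable_on_SigmaI[where g = "\<lambda>i. ?f i * (pi\<^sup>2 / 6)"])
       (use s in \<open>auto intro: has_sum_imp_summable\<close>)
  then show ?thesis by (simp add: power2_eq_square)
qed

lemma summable_on_grid_bound:
  fixes f :: "nat \<times> nat \<Rightarrow> real"
  assumes "\<And>i j. 0 \<le> f (i, j)" "\<And>i j. f (i, j) \<le> 1 / (real (Suc i) ^ 2 * real (Suc j) ^ 2)"
  shows "f summable_on UNIV"
  by (rule summable_on_comparison_test[OF has_sum_imp_summable[OF grid_has_sum]])
     (use assms in auto)

text \<open>The indices are m = i + 1 and p = i + j + 2, so these are the sums over m < p.\<close>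

definition zeta22 :: real where
  "zeta22 = (\<Sum>\<^sub>\<infinity>(i, j). 1 / (real (Suc i) ^ 2 * real (i + j + 2) ^ 2))"
definition zeta31 :: real where
  "zeta31 = (\<Sum>\<^sub>\<infinity>(i, j). 1 / (real (Suc i) * real (i + j + 2) ^ 3))"

lemma zeta22_has_sum:
  "((\<lambda>(i, j). 1 / (real (Suc i) ^ 2 * real (i + j + 2) ^ 2)) has_sum zeta22) UNIV"
  unfolding zeta22_def
  by (intro has_sum_infsum summable_on_grid_bound)
     (auto intro!: divide_left_mono mult_left_mono power_mono)

lemma zeta31_has_sum:
  "((\<lambda>(i, j). 1 / (real (Suc i) * real (i + j + 2) ^ 3)) has_sum zeta31) UNIV"
proof -
  have "real (Suc i) ^ 2 * real (Suc j) ^ 2 \<le> real (Suc i) * real (i + j + 2) ^ 3" for i j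
  proof -
    have "real (Suc i) * real (Suc j) ^ 2 \<le> real (i + j + 2) * real (i + j + 2) ^ 2"
      by (intro mult_mono power_mono) auto
    then have "real (Suc i) * (real (Suc i) * real (Suc j) ^ 2) \<le> real (Suc i) * (real (i + j + 2) * real (i + j + 2) ^ 2)"
      by (intro mult_left_mono) auto
    then show ?thesis by (simp only: power2_eq_square power3_eq_cube mult.assoc)
  qed
  then show ?thesis unfolding zeta31_def
    by (intro has_sum_infsum summable_on_grid_bound)
       (auto intro!: divide_left_mono mult_pos_pos simp del: of_nat_Suc of_nat_add)
qed

lemma has_sum_swap_UNIV:
  fixes f :: "'a \<Rightarrow> 'b \<Rightarrow> real"
  assumes "((\<lambda>(i, j). f i j) has_sum s) UNIV"
  shows "((\<lambda>(j, i). f i j) has_sum s) UNIV"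
  using assms by (subst has_sum_reindex_bij_witness[of _ prod.swap prod.swap _ "\<lambda>(i, j). f i j"]) auto

text \<open>The partial fraction step of the shuffle relations: each use trades a product of 1/m and
  1/n for terms with only one of them and a factor 1/(m + n).\<close>

lemma inverse_mult_split:
  fixes m n :: real
  assumes "m > 0" "n > 0"
  shows "inverse m * inverse n = (inverse m + inverse n) * inverse (m + n)"
  using assms by (simp add: field_simps)

text \<open>Partial fractions are applied to 1/(m n)^2 until no term contains both m and n. The
  terms in n and m + n are those in m and m + n with \<open>i\<close> and \<open>j\<close>
  exchanged, so each double zeta value occurs twice.\<close>

lemma zeta22_shuffle: "(pi\<^sup>2 / 6)\<^sup>2 = 2 * zeta22 + 4 * zeta31"
proof -
  let ?a = "\<lambda>i j::nat. 1 / (real (Suc i) ^ 2 * real (i + j + 2) ^ 2)"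
  let ?b = "\<lambda>i j::nat. 1 / (real (Suc i) * real (i + j + 2) ^ 3)"
  have eq: "1 / (m\<^sup>2 * n\<^sup>2) = 1 / (m\<^sup>2 * (m+n)\<^sup>2) + 1 / (n\<^sup>2 * (m+n)\<^sup>2)
       + 2 / (m * (m+n) ^ 3) + 2 / (n * (m+n) ^ 3)"
    if "m > 0" "n > 0" for m n :: real
  proof -
    define a b c where "a = inverse m" "b = inverse n" "c = inverse (m + n)"
    have ab: "a * b = (a + b) * c" using inverse_mult_split[OF that] by (simp add: a_b_c_def)
    have "a\<^sup>2 * b\<^sup>2 = (a * b) * (a * b)" by (simp add: power2_eq_square)
    also have "\<dots> = ((a + b) * c) * ((a + b) * c)" by (simp only: ab)
    also have "\<dots> = a\<^sup>2 * c\<^sup>2 + b\<^sup>2 * c\<^sup>2 + 2 * (a * b) * c\<^sup>2"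
      by (simp add: algebra_simps power2_eq_square)
    also have "\<dots> = a\<^sup>2 * c\<^sup>2 + b\<^sup>2 * c\<^sup>2 + 2 * a * c ^ 3 + 2 * b * c ^ 3"
      unfolding ab by (simp add: algebra_simps eval_nat_numeral)
    finally show ?thesis by (simp add: a_b_c_def divide_inverse power_inverse mult_ac)
  qed
  have "((\<lambda>x. (\<lambda>(i,j). ?a i j) x + (\<lambda>(j,i). ?a i j) x + 2 * (\<lambda>(i,j). ?b i j) x + 2 * (\<lambda>(j,i). ?b i j) x)
      has_sum (zeta22 + zeta22 + 2 * zeta31 + 2 * zeta31)) UNIV"
    by (intro has_sum_add has_sum_cmult_right zeta22_has_sum zeta31_has_sum
      zeta22_has_sum[THEN has_sum_swap_UNIV] zeta31_has_sum[THEN has_sum_swap_UNIV])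
  also have "(\<lambda>x. (\<lambda>(i,j). ?a i j) x + (\<lambda>(j,i). ?a i j) x + 2 * (\<lambda>(i,j). ?b i j) x + 2 * (\<lambda>(j,i). ?b i j) x)
     = (\<lambda>(i, j). 1 / (real (Suc i) ^ 2 * real (Suc j) ^ 2))"
    using eq[of "real (Suc i)" "real (Suc j)" for i j] by (auto simp: fun_eq_iff add_ac)
  finally show ?thesis using has_sum_unique[OF grid_has_sum] by fastforce
qed

text \<open>The grid splits into the triangles m < n and m > n, each giving \<open>zeta22\<close>,
  and the diagonal, giving zeta(4).\<close>

lemma zeta22_stuffle: "(pi\<^sup>2 / 6)\<^sup>2 = 2 * zeta22 + (\<Sum>i. 1 / real (Suc i) ^ 4)"
proof -
  let ?f = "\<lambda>(i, j). 1 / (real (Suc i) ^ 2 * real (Suc j) ^ 2)"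
  let ?g = "\<lambda>(i, j). 1 / (real (Suc i) ^ 2 * real (i + j + 2) ^ 2)"
  have "(?g has_sum zeta22) UNIV \<longleftrightarrow> (?f has_sum zeta22) {(i, j). i < j}"
    by (rule has_sum_reindex_bij_witness[of _ "\<lambda>(i, j). (i, j - i - 1)" "\<lambda>(i, k). (i, i + k + 1)"])
       (auto simp: add_ac)
  then have up: "(?f has_sum zeta22) {(i, j). i < j}" using zeta22_has_sum by simp
  have "(?f has_sum zeta22) {(i, j). i < j} \<longleftrightarrow> (?f has_sum zeta22) {(i, j). j < i}"
    by (rule has_sum_reindex_bij_witness[of _ prod.swap prod.swap]) (auto simp: mult.commute)
  then have dn: "(?f has_sum zeta22) {(i, j). j < i}" using up by simp
  have "((\<lambda>i. 1 / real (Suc i) ^ 4) has_sum (\<Sum>i. 1 / real (Suc i) ^ 4)) UNIV"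
    using summable_inverse_powers[of 4] by (intro sums_nonneg_imp_has_sum summable_sums) auto
  moreover have "((\<lambda>i. 1 / real (Suc i) ^ 4) has_sum s) UNIV \<longleftrightarrow> (?f has_sum s) {(i, j). i = j}" for s
    by (rule has_sum_reindex_bij_witness[of _ fst "\<lambda>i. (i, i)"])
       (auto simp flip: power_add simp del: of_nat_Suc)
  ultimately have di: "(?f has_sum (\<Sum>i. 1 / real (Suc i) ^ 4)) {(i, j). i = j}" by simp
  have "(?f has_sum (zeta22 + zeta22 + (\<Sum>i. 1 / real (Suc i) ^ 4))) (({(i, j). i < j} \<union> {(i, j). j < i}) \<union> {(i, j). i = j})"
    by (intro has_sum_Un_disjoint up dn di) auto
  moreover have "({(i, j). i < j} \<union> {(i, j). j < i}) \<union> {(i, j). i = j} = (UNIV :: (nat \<times> nat) set)"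
    by auto
  ultimately show ?thesis using has_sum_unique[OF grid_has_sum] by fastforce
qed

text \<open>Grouping by the larger index p = \<open>Suc j\<close> leaves the sum of 1/m over m < p.
  Hence \<open>harm j\<close> over a power of \<open>Suc j\<close> encodes H_(p-1), an offset that
  all later series share.\<close>

lemma zeta31_harm: "((\<lambda>j. harm j / real (Suc j) ^ 3) has_sum zeta31) UNIV"
proof -
  let ?f = "\<lambda>(j, i). 1 / (real (Suc i) * real (Suc j) ^ 3)"
  let ?g = "\<lambda>(i, j). 1 / (real (Suc i) * real (i + j + 2) ^ 3)"
  have "(?g has_sum zeta31) UNIV \<longleftrightarrow> (?f has_sum zeta31) (Sigma UNIV (\<lambda>j. {..<j}))"
    by (rule has_sum_reindex_bij_witness[of _ "\<lambda>(j, i). (i, j - i - 1)" "\<lambda>(i, k). (i + k + 1, i)"])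
       (auto simp: add_ac)
  then have up: "(?f has_sum zeta31) (Sigma UNIV (\<lambda>j. {..<j}))" using zeta31_has_sum by simp
  have "(\<Sum>i<j. 1 / (real (Suc i) * real (Suc j) ^ 3)) = harm j / real (Suc j) ^ 3" for j
    by (simp add: harm_altdef sum_divide_distrib divide_inverse mult_ac sum_distrib_left
        del: of_nat_Suc)
  then have "((\<lambda>i. 1 / (real (Suc i) * real (Suc j) ^ 3)) has_sum (harm j / real (Suc j) ^ 3)) {..<j}" for j
    by (intro has_sum_finiteI) auto
  then show ?thesis
    by (intro has_sum_SigmaD[OF up]) auto
qed

text \<open>Since 1/(n (m + n)) = (1/n - 1/(m + n)) / m, the partial sums telescope; what remains
  beside H_m is a block of m consecutive reciprocals, which tends to 0.\<close>

lemma telescope_has_sum: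
  "((\<lambda>j. 1 / (real (Suc j) * real (Suc i + Suc j))) has_sum (harm (Suc i) / real (Suc i))) UNIV"
proof (rule sums_nonneg_imp_has_sum)
  let ?m = "Suc i"
  have part: "(\<Sum>j<n. 1 / (real (Suc j) * real (?m + Suc j))) =
      (harm ?m + harm n - harm (n + ?m)) / ?m" for n
  proof (induction n)
    case (Suc n)
    have "1 / (p * (m + p)) = (inverse p - inverse (m + p)) / m" if "p > 0" "m > 0" for p m :: real
      using that by (simp add: divide_simps)
    from this[of "real (Suc n)" "real ?m"]
    have "1 / (real (Suc n) * real (?m + Suc n)) = (inverse (real (Suc n)) - inverse (real (Suc (n + ?m)))) / ?m"
      by (simp add: add_ac)
    moreover have "harm (Suc n + ?m) = harm (n + ?m) + (inverse (real (Suc (n + ?m))) :: real)"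
      by (simp add: harm_Suc)
    moreover have "(x + y - z) / c + (p - q) / c = (x + (y + p) - (z + q)) / c" for x y z p q c :: real
      by (simp add: diff_divide_distrib add_divide_distrib)
    ultimately show ?case
      by (simp only: sum.lessThan_Suc Suc.IH harm_Suc[of n])
  qed (simp add: harm_expand)
  have lim: "(\<lambda>n. harm (n + k) - harm n :: real) \<longlonglongrightarrow> 0" for k
  proof (induction k)
    case (Suc k)
    have "(\<lambda>n. (harm (n + k) - harm n) + inverse (real (Suc (n + k)))) \<longlonglongrightarrow> 0 + 0"
      by (intro tendsto_add Suc LIMSEQ_ignore_initial_segment[OF LIMSEQ_inverse_real_of_nat])
    then show ?case by (simp add: harm_Suc algebra_simps)
  qed simp
  have "(\<lambda>n. (harm ?m - (harm (n + ?m) - harm n)) / real ?m) \<longlonglongrightarrow> (harm ?m - 0) / real ?m"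
    by (intro tendsto_intros lim) auto
  then show "(\<lambda>j. 1 / (real (Suc j) * real (Suc i + Suc j))) sums (harm (Suc i) / real (Suc i))"
    unfolding sums_def part by (simp add: algebra_simps del: of_nat_Suc)
qed auto

text \<open>The double sum of 1/(m^2 n (m + n)) is evaluated twice: summing over n gives H_m / m^3 =
  1/m^4 + H_(m-1) / m^3, and partial fractions give double zeta values. The outcome is Euler's
  relation zeta(4) = zeta(2,2) + zeta(3,1).\<close>

lemma zeta31_telescope: "(\<Sum>i. 1 / real (Suc i) ^ 4) + zeta31 = zeta22 + 2 * zeta31"
proof -
  let ?a = "\<lambda>i j::nat. 1 / (real (Suc i) ^ 2 * real (i + j + 2) ^ 2)"
  let ?b = "\<lambda>i j::nat. 1 / (real (Suc i) * real (i + j + 2) ^ 3)"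
  let ?z = "\<Sum>i. 1 / real (Suc i) ^ 4"
  let ?t = "\<lambda>i j. (1 / real (Suc i) ^ 2) * (1 / (real (Suc j) * real (Suc i + Suc j)))"
  have eq: "1 / m\<^sup>2 * (1 / (n * (m+n))) = 1 / (m\<^sup>2 * (m+n)\<^sup>2)
       + 1 / (m * (m+n) ^ 3) + 1 / (n * (m+n) ^ 3)"
    if "m > 0" "n > 0" for m n :: real
  proof -
    define a b c where "a = inverse m" "b = inverse n" "c = inverse (m + n)"
    have ab: "a * b = (a + b) * c" using inverse_mult_split[OF that] by (simp add: a_b_c_def)
    have "a\<^sup>2 * (b * c) = a * (a * b) * c" by (simp add: power2_eq_square)
    also have "\<dots> = a * ((a + b) * c) * c" by (simp only: ab)
    also have "\<dots> = a\<^sup>2 * c\<^sup>2 + (a * b) * c\<^sup>2"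
      by (simp add: algebra_simps power2_eq_square)
    also have "\<dots> = a\<^sup>2 * c\<^sup>2 + a * c ^ 3 + b * c ^ 3"
      unfolding ab by (simp add: algebra_simps eval_nat_numeral)
    finally show ?thesis by (simp add: a_b_c_def divide_inverse power_inverse mult_ac)
  qed
  have "((\<lambda>x. (\<lambda>(i,j). ?a i j) x + (\<lambda>(i,j). ?b i j) x + (\<lambda>(j,i). ?b i j) x)
      has_sum (zeta22 + zeta31 + zeta31)) UNIV"
    by (intro has_sum_add zeta22_has_sum zeta31_has_sum
      zeta22_has_sum[THEN has_sum_swap_UNIV] zeta31_has_sum[THEN has_sum_swap_UNIV])
  also have "(\<lambda>x. (\<lambda>(i,j). ?a i j) x + (\<lambda>(i,j). ?b i j) x + (\<lambda>(j,i). ?b i j) x) = (\<lambda>(i, j). ?t i j)"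
  proof
    fix x :: "nat \<times> nat"
    obtain i j where x: "x = (i, j)" by (cases x)
    have e: "real (i + j + 2) = real (Suc i) + real (Suc j)" "real (j + i + 2) = real (Suc i) + real (Suc j)"
       "real (Suc i + Suc j) = real (Suc i) + real (Suc j)" by simp_all
    show "(\<lambda>(i,j). ?a i j) x + (\<lambda>(i,j). ?b i j) x + (\<lambda>(j,i). ?b i j) x = (\<lambda>(i, j). ?t i j) x"
      unfolding x prod.case e by (rule eq[symmetric]) simp_all
  qed
  finally have "((\<lambda>(i, j). ?t i j) has_sum (zeta22 + zeta31 + zeta31)) (Sigma UNIV (\<lambda>_. UNIV))" by simp
  then have 1: "((\<lambda>i. (1 / real (Suc i) ^ 2) * (harm (Suc i) / real (Suc i))) has_sum (zeta22 + zeta31 + zeta31)) UNIV"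
    by (rule has_sum_SigmaD) (unfold prod.case, rule has_sum_cmult_right[OF telescope_has_sum])
  have "(\<lambda>i. 1 / real (Suc i) ^ 4) sums ?z"
    using summable_inverse_powers[of 4] by (simp add: summable_sums)
  then have "((\<lambda>i. 1 / real (Suc i) ^ 4) has_sum ?z) UNIV"
    by (intro sums_nonneg_imp_has_sum) auto
  from has_sum_add[OF this zeta31_harm]
  have "((\<lambda>i. 1 / real (Suc i) ^ 4 + harm i / real (Suc i) ^ 3) has_sum (?z + zeta31)) UNIV" .
  also have "(\<lambda>i. 1 / real (Suc i) ^ 4 + harm i / real (Suc i) ^ 3) = (\<lambda>i. (1 / real (Suc i) ^ 2) * (harm (Suc i) / real (Suc i)))"
  proof
    fix i
    have "1 / c ^ 4 + h / c ^ 3 = (1 / c\<^sup>2) * ((h + inverse c) / c)" if "c > 0" for h c :: real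
      using that by (simp add: field_simps eval_nat_numeral)
    from this[of "real (Suc i)" "harm i"]
    show "1 / real (Suc i) ^ 4 + harm i / real (Suc i) ^ 3 = (1 / real (Suc i) ^ 2) * (harm (Suc i) / real (Suc i))"
      by (simp add: harm_Suc)
  qed
  finally show ?thesis using 1 has_sum_unique by fastforce
qed

text \<open>The shuffle, stuffle and telescoping relations are linear and force zeta(2,2) = 3
  zeta(3,1), zeta(4) = 4 zeta(3,1) and zeta(2)^2 = 10 zeta(3,1).\<close>

lemma zeta4: "(\<Sum>i. 1 / real (Suc i) ^ 4) = pi ^ 4 / 90"
  and zeta31: "zeta31 = pi ^ 4 / 360"
proof -
  have "(pi\<^sup>2 / 6)\<^sup>2 = pi ^ 4 / 36" by (simp add: power_divide)
  then show "(\<Sum>i. 1 / real (Suc i) ^ 4) = pi ^ 4 / 90" "zeta31 = pi ^ 4 / 360"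
    using zeta22_shuffle zeta22_stuffle zeta31_telescope by linarith+
qed


section \<open>Harmonic sums over odd and over even indices\<close>

lemma sums_group2: "f sums s \<Longrightarrow> (\<lambda>k. f (2 * k) + f (2 * k + 1)) sums s" for f :: "nat \<Rightarrow> real"
  using sums_group[of f s 2] by (simp add: mult.commute numeral_2_eq_2)

text \<open>Adding the alternating sum doubles the terms with even \<open>j\<close>, which are those
  with odd denominator \<open>Suc j\<close>, and cancels the others.\<close>

lemma odd_part_sums:
  assumes "(\<lambda>j. (-1) ^ j * (harm j / real (Suc j) ^ 3)) sums v"
  shows "(\<lambda>k. harm (2 * k) / real (2 * k + 1) ^ 3) sums ((zeta31 + v) / 2)"
proof -
  have "(\<lambda>j. harm j / real (Suc j) ^ 3 + (-1) ^ j * (harm j / real (Suc j) ^ 3)) sums (zeta31 + v)"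
    by (intro sums_add assms has_sum_imp_sums[OF zeta31_harm])
  from sums_divide[OF sums_group2[OF this], of 2] show ?thesis
    by simp
qed

lemma sum_odd_reciprocals: "(\<Sum>j<Suc k. 1 / real (2 * j + 1)) = harm (2 * k + 1) - harm k / 2"
proof (induction k)
  case (Suc k)
  have "inverse (real (Suc (2 * k + 1))) = inverse (real (Suc k)) / 2"
    by (simp add: field_simps)
  moreover have "2 * Suc k + 1 = Suc (Suc (2 * k + 1))" by simp
  then have "harm (2 * Suc k + 1) = harm (2 * k + 1) + inverse (real (Suc (2 * k + 1))) + 1 / real (2 * Suc k + 1)"
    by (simp only: harm_Suc inverse_eq_divide)
  ultimately show ?case
    using Suc by (simp only: sum.lessThan_Suc[of _ "Suc k"] harm_Suc[of k]) (simp add: add_divide_distrib)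
qed (simp add: harm_expand)

text \<open>With n = \<open>Suc k\<close>, O_n = H_(2n-1) - H_(n-1) / 2, and (2n)^3 = 8 n^3 turns
  O_n / (2 n^3) into 4 H_(2n-1) / (2n)^3 - H_(n-1) / (4 n^3). The first part is four times the sum
  over even indices, that is, \<open>zeta31\<close> minus the odd part.\<close>

lemma even_part_sums:
  assumes "(\<lambda>k. harm (2 * k) / real (2 * k + 1) ^ 3) sums u"
  shows "(\<lambda>k. (\<Sum>j<Suc k. 1 / real (2 * j + 1)) / (2 * real (Suc k) ^ 3)) sums (15 / 4 * zeta31 - 4 * u)"
proof -
  have "(\<lambda>k. 4 * ((harm (2 * k) / real (Suc (2 * k)) ^ 3 + harm (2 * k + 1) / real (Suc (2 * k + 1)) ^ 3)
      - harm (2 * k) / real (2 * k + 1) ^ 3) - (harm k / real (Suc k) ^ 3) / 4) sums (4 * (zeta31 - u) - zeta31 / 4)"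
    by (intro sums_diff sums_mult sums_divide sums_group2[of "\<lambda>j. harm j / real (Suc j) ^ 3"]
        has_sum_imp_sums[OF zeta31_harm] assms)
  also have "(\<lambda>k. 4 * ((harm (2 * k) / real (Suc (2 * k)) ^ 3 + harm (2 * k + 1) / real (Suc (2 * k + 1)) ^ 3)
      - harm (2 * k) / real (2 * k + 1) ^ 3) - (harm k / real (Suc k) ^ 3) / 4) =
     (\<lambda>k. (\<Sum>j<Suc k. 1 / real (2 * j + 1)) / (2 * real (Suc k) ^ 3))"
  proof
    fix k
    have "real (Suc (2 * k + 1)) ^ 3 = 8 * real (Suc k) ^ 3"
      using power_mult_distrib[of 2 "real (Suc k)" 3] by simp
    moreover have "4 * (x + h / (8 * c) - x) - (g / c) / 4 = (h - g / 2) / (2 * c)" if "c > 0" for x h g c :: real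
      using that by (simp add: field_simps)
    from this[of "real (Suc k) ^ 3"]
    have "4 * (x + h / (8 * real (Suc k) ^ 3) - x) - (g / real (Suc k) ^ 3) / 4 = (h - g / 2) / (2 * real (Suc k) ^ 3)"
      for x h g by simp
    ultimately show "4 * ((harm (2 * k) / real (Suc (2 * k)) ^ 3 + harm (2 * k + 1) / real (Suc (2 * k + 1)) ^ 3)
      - harm (2 * k) / real (2 * k + 1) ^ 3) - (harm k / real (Suc k) ^ 3) / 4
      = (\<Sum>j<Suc k. 1 / real (2 * j + 1)) / (2 * real (Suc k) ^ 3)"
      unfolding sum_odd_reciprocals by (simp only: Suc_eq_plus1)
  qed
  finally show ?thesis by (simp add: algebra_simps)
qed

section \<open>Polylogarithms with coefficients\<close>

text \<open>For \<open>c = harm\<close> this is the Nielsen polylogarithm S_(m-1,2), the series of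
  H_(n-1) x^n / n^m. Keeping the coefficients general allows differentiation and boundary continuity
  to be proved once for it and for Li_m.\<close>

definition gpolylog :: "(nat \<Rightarrow> real) \<Rightarrow> nat \<Rightarrow> real \<Rightarrow> real" where
  "gpolylog c m x = (\<Sum>j. c j * x ^ Suc j / real (Suc j) ^ m)"

lemma polylog_eq_gpolylog: "polylog m = gpolylog (\<lambda>_. 1) m"
  by (simp add: polylog_def gpolylog_def fun_eq_iff)

lemma gpolylog_0 [simp]: "gpolylog c m 0 = 0"
  by (simp add: gpolylog_def)

lemma summable_gpolylog:
  assumes "\<And>j. \<bar>c j\<bar> \<le> real (Suc j)" "\<bar>x\<bar> < 1"
  shows "summable (\<lambda>j. c j * x ^ Suc j / real (Suc j) ^ m)"
proof (rule summable_comparison_test')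
  have "summable (\<lambda>n. diffs (\<lambda>_. 1) n * \<bar>x\<bar> ^ n)"
    using assms(2) by (intro termdiff_converges[where K = 1]) (auto simp: summable_geometric)
  then show "summable (\<lambda>n. real (Suc n) * \<bar>x\<bar> ^ n)" by (simp add: diffs_def)
next
  fix n :: nat
  have "\<bar>c n\<bar> * \<bar>x\<bar> ^ Suc n / real (Suc n) ^ m \<le> \<bar>c n\<bar> * \<bar>x\<bar> ^ Suc n / 1"
    by (intro divide_left_mono) (auto simp: one_le_power simp del: of_nat_Suc)
  also have "\<dots> \<le> real (Suc n) * \<bar>x\<bar> ^ n"
    using assms by (auto intro!: mult_mono mult_left_le_one_le)
  finally show "norm (c n * x ^ Suc n / real (Suc n) ^ m) \<le> real (Suc n) * \<bar>x\<bar> ^ n"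
    by (simp add: abs_mult power_abs)
qed

lemma has_real_derivative_gpolylog:
  assumes c: "\<And>j. \<bar>c j\<bar> \<le> real (Suc j)" and x: "\<bar>x\<bar> < 1" "x \<noteq> 0"
  shows "(gpolylog c (Suc m) has_real_derivative gpolylog c m x / x) (at x)"
proof -
  \<comment> \<open>The coefficients with respect to powers starting at z^0: the constant one is 0,
    and \<open>diffs C n\<close> is \<open>c n / real (Suc n) ^ m\<close>, one order lower.\<close>
  define C where "C = (\<lambda>n. case n of 0 \<Rightarrow> 0 | Suc j \<Rightarrow> c j / real (Suc j) ^ Suc m)"
  have C_sums: "(\<lambda>n. C n * z ^ n) sums gpolylog c (Suc m) z" if "norm z < 1" for z
  proof -
    have "(\<lambda>j. C (Suc j) * z ^ Suc j) sums gpolylog c (Suc m) z"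
      using summable_sums[OF summable_gpolylog[OF c, of z "Suc m"]] that
      by (simp add: C_def gpolylog_def)
    then show ?thesis by (subst (asm) sums_Suc_iff) (simp add: C_def)
  qed
  have "((\<lambda>z. \<Sum>n. C n * z ^ n) has_real_derivative (\<Sum>n. diffs C n * x ^ n)) (at x)"
    by (rule termdiffs_strong'[where K = 1]) (use C_sums x in \<open>auto intro: sums_summable\<close>)
  moreover have "(\<Sum>n. diffs C n * x ^ n) = gpolylog c m x / x"
  proof -
    have "(\<lambda>j. c j * x ^ Suc j / real (Suc j) ^ m / x) sums (gpolylog c m x / x)"
      using summable_sums[OF summable_gpolylog[OF c, of x m]] x
      by (intro sums_divide) (simp add: gpolylog_def)
    moreover have "(\<lambda>j. c j * x ^ Suc j / real (Suc j) ^ m / x) = (\<lambda>n. diffs C n * x ^ n)"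
      using x by (auto simp: fun_eq_iff diffs_def C_def simp del: of_nat_Suc)
    ultimately show ?thesis by (simp add: sums_iff)
  qed
  moreover have "eventually (\<lambda>z. (\<Sum>n. C n * z ^ n) = gpolylog c (Suc m) z) (nhds x)"
    using eventually_nhds_in_open[of "ball 0 1" x] x
    by (auto elim!: eventually_mono simp: C_sums[THEN sums_unique, symmetric])
  ultimately show ?thesis using DERIV_cong_ev by fastforce
qed

text \<open>The Weierstrass test reaches the closed interval. The endpoints matter, since the
  arguments 1 and -1 carry the zeta values and the alternating sum.\<close>

lemma continuous_on_gpolylog:
  assumes "summable (\<lambda>j. \<bar>c j\<bar> / real (Suc j) ^ m)"
  shows "continuous_on {-1..1} (gpolylog c m)"
proof -
  have "uniform_limit {-1..1} (\<lambda>n x. \<Sum>j<n. c j * x ^ Suc j / real (Suc j) ^ m)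
      (\<lambda>x. \<Sum>j. c j * x ^ Suc j / real (Suc j) ^ m) sequentially"
  proof (rule Weierstrass_m_test[OF _ assms])
    fix n and x :: real assume "x \<in> {-1..1}"
    then have "\<bar>x\<bar> ^ Suc n \<le> 1" by (intro power_le_one) auto
    then have "\<bar>c n\<bar> * \<bar>x\<bar> ^ Suc n / real (Suc n) ^ m \<le> \<bar>c n\<bar> * 1 / real (Suc n) ^ m"
      by (intro divide_right_mono mult_left_mono) auto
    then show "norm (c n * x ^ Suc n / real (Suc n) ^ m) \<le> \<bar>c n\<bar> / real (Suc n) ^ m"
      by (simp add: abs_mult power_abs)
  qed
  then have "continuous_on {-1..1} (\<lambda>x. \<Sum>j. c j * x ^ Suc j / real (Suc j) ^ m)"
    by (rule uniform_limit_theorem[rotated]) (auto intro!: always_eventually continuous_intros)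
  then show ?thesis by (simp add: gpolylog_def[abs_def])
qed

lemma harm_le_Suc: "harm j \<le> real (Suc j)"
proof -
  have "harm j \<le> (\<Sum>k=1..j. 1 :: real)"
    unfolding harm_def by (intro sum_mono) (auto simp: field_simps)
  then show ?thesis by simp
qed

text \<open>At the endpoints, order m = 2 calls for a sublinear bound: \<open>harm_le_Suc\<close>
  would leave terms of size 1/n. In the induction, the mean inequality for j and j + 1 shows that 2
  sqrt j grows by at least 1/(j + 1).\<close>

lemma harm_le_sqrt: "harm j \<le> 2 * sqrt (real j)"
proof (induction j)
  case (Suc j)
  have "sqrt (Suc j) * sqrt j \<le> j + 1/2"
    using arith_geo_mean_sqrt[of "real (Suc j)" "real j"] by (simp add: real_sqrt_mult)
  then have "1 \<le> 2 * (real (Suc j) - sqrt (Suc j) * sqrt j)" by simp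
  also have "real (Suc j) = sqrt (Suc j) * sqrt (Suc j)" by simp
  finally have "1 \<le> 2 * sqrt (Suc j) * (sqrt (Suc j) - sqrt j)" by (simp add: algebra_simps)
  moreover have "2 * sqrt (Suc j) * (sqrt (Suc j) - sqrt j) \<le> 2 * Suc j * (sqrt (Suc j) - sqrt j)"
  proof -
    have "sqrt (Suc j) \<le> Suc j"
      by (rule real_le_lsqrt) (auto simp: power2_eq_square)
    then show ?thesis by (intro mult_right_mono) auto
  qed
  ultimately have "inverse (real (Suc j)) \<le> 2 * (sqrt (Suc j) - sqrt j)"
    by (simp add: field_simps)
  with Suc show ?case by (simp add: harm_Suc)
qed (simp add: harm_expand)

lemma summable_harm:
  assumes "m \<ge> 2"
  shows "summable (\<lambda>j. \<bar>harm j\<bar> / real (Suc j) ^ m)"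
proof (rule summable_comparison_test')
  have "summable (\<lambda>n. real n powr (-3/2))" by (simp add: summable_real_powr_iff)
  then show "summable (\<lambda>n. 2 * real (Suc n) powr (-3/2))"
    by (subst summable_cmult_iff, subst summable_Suc_iff) auto
next
  fix n
  have "\<bar>harm n\<bar> / real (Suc n) ^ m \<le> \<bar>harm n\<bar> / real (Suc n) ^ 2"
    using assms by (intro divide_left_mono power_increasing mult_pos_pos zero_less_power abs_ge_zero) auto
  also have "\<dots> \<le> 2 * sqrt (real (Suc n)) / real (Suc n) ^ 2"
  proof (intro divide_right_mono)
    have "sqrt (real n) \<le> sqrt (real (Suc n))" by simp
    with harm_le_sqrt[of n] show "\<bar>harm n\<bar> \<le> 2 * sqrt (real (Suc n))"
      unfolding abs_harm by linarith
  qed simp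
  also have "\<dots> = 2 * real (Suc n) powr (-3/2)"
  proof -
    have "sqrt c / c ^ 2 = c powr (-3/2)" if "c > 0" for c :: real
      using that powr_diff[of c "1/2" 2] by (simp add: powr_half_sqrt)
    from this[of "real (Suc n)"] show ?thesis by simp
  qed
  finally show "norm (\<bar>harm n\<bar> / real (Suc n) ^ m) \<le> 2 * real (Suc n) powr (-3/2)" by simp
qed

section \<open>Generating functions of the harmonic numbers\<close>

lemma harm_convolution:
  "(\<Sum>i\<le>k. 1 / of_nat (Suc i) * (1 / of_nat (Suc (k - i)))) = 2 * harm (Suc k) / (of_nat (k + 2) :: 'a :: real_normed_field)"
proof -
  have "1 / of_nat (Suc i) * (1 / of_nat (Suc (k - i))) = (inverse (of_nat (Suc i)) + inverse (of_nat (Suc (k - i)))) / (of_nat (k + 2) :: 'a)"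
    if "i \<le> k" for i
  proof -
    have "of_nat (k + 2) = (of_nat (Suc i) + of_nat (Suc (k - i)) :: 'a)"
      using that by (subst of_nat_add[symmetric]) simp
    moreover have "(of_nat (Suc i) + of_nat (Suc (k - i)) :: 'a) \<noteq> 0"
      by (subst of_nat_add[symmetric], subst of_nat_eq_0_iff) simp
    moreover have "1 / p * (1 / q) = (inverse p + inverse q) / (p + q)" if "p \<noteq> 0" "q \<noteq> 0" "p + q \<noteq> 0" for p q :: 'a
      using that by (simp add: divide_simps add.commute)
    ultimately show ?thesis
      by (simp del: of_nat_Suc of_nat_add)
  qed
  then have "(\<Sum>i\<le>k. 1 / of_nat (Suc i) * (1 / of_nat (Suc (k - i)))) =
     ((\<Sum>i\<le>k. inverse (of_nat (Suc i))) + (\<Sum>i\<le>k. inverse (of_nat (Suc (k - i)))) :: 'a) / of_nat (k + 2)"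
    unfolding sum.distrib[symmetric] sum_divide_distrib by (intro sum.cong) auto
  also have "(\<Sum>i\<le>k. inverse (of_nat (Suc (k - i))) :: 'a) = (\<Sum>i\<le>k. inverse (of_nat (Suc i)))"
    by (rule sum.reindex_bij_witness[of _ "\<lambda>i. k - i" "\<lambda>i. k - i"]) auto
  also have "(\<Sum>i\<le>k. inverse (of_nat (Suc i))) = (harm (Suc k) :: 'a)"
    by (simp add: harm_altdef lessThan_Suc_atMost)
  finally show ?thesis by simp
qed

text \<open>The Cauchy square of the logarithm series, with coefficients given by
  \<open>harm_convolution\<close>. It is stated over a general field because it is used on (-1, 1)
  and on the complex disc.\<close>

lemma harm_powser_sums:
  fixes z :: "'a :: {real_normed_field, banach}"
  assumes "norm z < 1" and "(\<lambda>j. z ^ Suc j / of_nat (Suc j)) sums l"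
  shows "(\<lambda>j. harm j * z ^ Suc j / of_nat (Suc j)) sums (l\<^sup>2 / 2)"
proof -
  let ?a = "\<lambda>j. z ^ Suc j / of_nat (Suc j)"
  have "summable (\<lambda>j. norm (?a j))"
  proof (rule summable_comparison_test')
    show "summable (\<lambda>n. norm z ^ Suc n)"
      using assms(1) by (subst summable_Suc_iff) (simp add: summable_geometric)
    fix n
    have "norm z ^ Suc n / real (Suc n) \<le> norm z ^ Suc n / 1"
      by (intro divide_left_mono) auto
    then show "norm (norm (?a n)) \<le> norm z ^ Suc n"
      by (simp add: norm_divide norm_power norm_mult del: of_nat_Suc)
  qed
  from Cauchy_product_sums[OF this this]
  have "(\<lambda>k. \<Sum>i\<le>k. ?a i * ?a (k - i)) sums (l * l)"
    using assms(2) by (simp add: sums_iff)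
  moreover have "(\<Sum>i\<le>k. ?a i * ?a (k - i)) = 2 * (harm (Suc k) * z ^ Suc (Suc k) / of_nat (Suc (Suc k)))" for k
  proof -
    have "?a i * ?a (k - i) = z ^ (k + 2) * (1 / of_nat (Suc i) * (1 / of_nat (Suc (k - i))))" if "i \<le> k" for i
      using that by (simp flip: power_add power_Suc del: of_nat_Suc)
    then have "(\<Sum>i\<le>k. ?a i * ?a (k - i)) = z ^ (k + 2) * (\<Sum>i\<le>k. 1 / of_nat (Suc i) * (1 / of_nat (Suc (k - i))))"
      unfolding sum_distrib_left by (intro sum.cong) auto
    then show ?thesis unfolding harm_convolution by simp
  qed
  ultimately have "(\<lambda>k. 2 * (harm (Suc k) * z ^ Suc (Suc k) / of_nat (Suc (Suc k)))) sums (l * l)"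
    by simp
  from sums_mult[OF this, of "1/2"]
  have "(\<lambda>k. harm (Suc k) * z ^ Suc (Suc k) / of_nat (Suc (Suc k))) sums (l\<^sup>2 / 2)"
    by (simp add: power2_eq_square del: of_nat_Suc)
  then show ?thesis by (subst (asm) sums_Suc_iff) (simp add: harm_expand)
qed

lemma ln_sums: "\<bar>x\<bar> < 1 \<Longrightarrow> (\<lambda>j. x ^ Suc j / real (Suc j)) sums (- ln (1 - x))"
  using sums_minus[OF ln_series'[of "-x"]] by (subst sums_Suc_iff) simp

lemma Ln_sums: "norm z < 1 \<Longrightarrow> (\<lambda>j. z ^ Suc j / of_nat (Suc j)) sums (- Ln (1 - z))"
  using sums_minus[OF Ln_series'[of "-z"]] by (subst sums_Suc_iff) simp

lemma gpolylog_1_1: "\<bar>x\<bar> < 1 \<Longrightarrow> gpolylog (\<lambda>_. 1) 1 x = - ln (1 - x)"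
  using ln_sums[of x] by (simp add: gpolylog_def sums_iff)

lemma gpolylog_harm_1: "\<bar>x\<bar> < 1 \<Longrightarrow> gpolylog harm 1 x = (ln (1 - x))\<^sup>2 / 2"
  using harm_powser_sums[OF _ ln_sums, of x] by (simp add: gpolylog_def sums_iff)

section \<open>Boundary limits for identities proved by differentiation\<close>

lemma abs_gpolylog_le:
  assumes "summable (\<lambda>j. \<bar>c j\<bar> / real (Suc j) ^ m)" "\<bar>x\<bar> \<le> 1"
  shows "\<bar>gpolylog c m x\<bar> \<le> (\<Sum>j. \<bar>c j\<bar> / real (Suc j) ^ m) * \<bar>x\<bar>"
proof -
  have le: "norm (c j * x ^ Suc j / real (Suc j) ^ m) \<le> \<bar>c j\<bar> / real (Suc j) ^ m * \<bar>x\<bar>" for j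
  proof -
    have "\<bar>x\<bar> ^ Suc j \<le> \<bar>x\<bar>"
      using assms(2) power_decreasing[of 1 "Suc j" "\<bar>x\<bar>"] by simp
    then have "\<bar>c j\<bar> * \<bar>x\<bar> ^ Suc j / real (Suc j) ^ m \<le> \<bar>c j\<bar> * \<bar>x\<bar> / real (Suc j) ^ m"
      by (intro divide_right_mono mult_left_mono) auto
    then show ?thesis by (simp add: abs_mult power_abs)
  qed
  have sm: "summable (\<lambda>j. \<bar>c j\<bar> / real (Suc j) ^ m * \<bar>x\<bar>)"
    by (intro summable_mult2 assms)
  show ?thesis
    unfolding gpolylog_def using norm_suminf_le[OF le sm] suminf_mult2[OF assms(1), of "\<bar>x\<bar>"]
    by simp
qed

text \<open>The series vanishes linearly at 0, which beats the logarithm. Separate \<open>f\<close>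
  and \<open>g\<close> allow the logarithm to be taken at the positive (1 - x)/x and the series at
  the negative 1 - 1/x.\<close>

lemma tendsto_ln_mult_gpolylog_0:
  assumes c: "summable (\<lambda>j. \<bar>c j\<bar> / real (Suc j) ^ m)"
    and f: "filterlim f (at_right 0) F" and g: "eventually (\<lambda>x. \<bar>g x\<bar> \<le> \<bar>f x\<bar>) F"
  shows "((\<lambda>x. ln (f x) * gpolylog c m (g x)) \<longlongrightarrow> 0) F"
proof -
  define K where "K = (\<Sum>j. \<bar>c j\<bar> / real (Suc j) ^ m)"
  have "((\<lambda>y::real. K * \<bar>ln y * y\<bar>) \<longlongrightarrow> 0) (at_right 0)" by real_asymp
  then have lim: "((\<lambda>x. K * \<bar>ln (f x) * f x\<bar>) \<longlongrightarrow> 0) F"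
    by (rule filterlim_compose[OF _ f])
  have ev1: "eventually (\<lambda>x. f x \<in> {0<..<1}) F"
    by (rule eventually_compose_filterlim[OF _ f]) (auto simp: eventually_at_right_field intro: exI[of _ 1])
  show ?thesis
  proof (rule Lim_null_comparison[OF _ lim])
    show "eventually (\<lambda>x. norm (ln (f x) * gpolylog c m (g x)) \<le> K * \<bar>ln (f x) * f x\<bar>) F"
      using ev1 g
    proof eventually_elim
      case (elim x)
      then have "\<bar>gpolylog c m (g x)\<bar> \<le> K * \<bar>g x\<bar>" by (intro abs_gpolylog_le[OF c, folded K_def]) auto
      also have "\<dots> \<le> K * \<bar>f x\<bar>"
        using elim c by (intro mult_left_mono) (auto simp: K_def intro!: suminf_nonneg)
      finally have "\<bar>ln (f x)\<bar> * \<bar>gpolylog c m (g x)\<bar> \<le> \<bar>ln (f x)\<bar> * (K * \<bar>f x\<bar>)"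
        by (intro mult_left_mono) auto
      then show ?case by (simp add: abs_mult mult_ac)
    qed
  qed
qed

text \<open>Used to compare the value at 1/2 with the limit at 1; the interval is half-open because
  ln (1 - x) is singular at 1.\<close>

lemma eq_left_limit_of_zero_derivative:
  fixes G :: "real \<Rightarrow> real"
  assumes "a < b" "continuous_on {a..<b} G"
    and "\<And>x. a < x \<Longrightarrow> x < b \<Longrightarrow> (G has_real_derivative 0) (at x)"
    and "(G \<longlongrightarrow> l) (at_left b)"
  shows "G a = l"
proof -
  have "G x = G a" if "a < x" "x < b" for x
    using assms that by (intro DERIV_isconst_end) (auto intro: continuous_on_subset)
  then have "eventually (\<lambda>x. G x = G a) (at_left b)"
    using assms(1) by (auto simp: eventually_at_left_field)
  then have "((\<lambda>_. G a) \<longlongrightarrow> l) (at_left b)"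
    using assms(4) tendsto_cong by fast
  then show ?thesis by (simp add: tendsto_const_iff)
qed

lemma tendsto_gpolylog_compose:
  assumes "summable (\<lambda>j. \<bar>c j\<bar> / real (Suc j) ^ m)"
    "(f \<longlongrightarrow> y) F" "y \<in> {-1..1}" "eventually (\<lambda>x. f x \<in> {-1..1}) F"
  shows "((\<lambda>x. gpolylog c m (f x)) \<longlongrightarrow> gpolylog c m y) F"
  using continuous_on_tendsto_compose[OF continuous_on_gpolylog[OF assms(1)] assms(2-4)] .

text \<open>
  The function R below satisfies R(x) + R(1 - x) = (ln x)^2 (ln (1 - x))^2 / 4 + const,
  which determines R(1/2).
\<close>

lemma gpolylog_harm_3_half_reflection:
  "ln (1/2) * gpolylog harm 2 (1/2) - gpolylog harm 3 (1/2) = ln 2 ^ 4 / 8 - gpolylog harm 3 1 / 2"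
proof -
  let ?s = "gpolylog harm"
  define R where "R = (\<lambda>x. ln x * ?s 2 x - ?s 3 x)"
  define G where "G = (\<lambda>x. R x + R (1 - x) - (ln x)\<^sup>2 * (ln (1 - x))\<^sup>2 / 4)"
  have R': "(R has_real_derivative ln x * (ln (1 - x))\<^sup>2 / (2 * x)) (at x)" if "0 < x" "x < 1" for x
  proof -
    have "(?s (Suc 1) has_real_derivative ?s 1 x / x) (at x)" "(?s (Suc 2) has_real_derivative ?s 2 x / x) (at x)"
      using that by (intro has_real_derivative_gpolylog; simp add: harm_le_Suc del: of_nat_Suc)+
    then have [derivative_intros]: "(?s 2 has_real_derivative ?s 1 x / x) (at x)" "(?s 3 has_real_derivative ?s 2 x / x) (at x)"
      by (simp_all add: eval_nat_numeral)
    show ?thesis unfolding R_def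
      using that gpolylog_harm_1[of x]
      by (auto intro!: derivative_eq_intros simp: field_simps)
  qed
  have "G (1/2) = - ?s 3 1"
  proof (rule eq_left_limit_of_zero_derivative[where G = G and a = "1/2" and b = 1])
    show "(G has_real_derivative 0) (at x)" if "1/2 < x" "x < 1" for x
    proof -
      have *: "((\<lambda>x. R (1 - x)) has_real_derivative (ln (1 - x) * (ln x)\<^sup>2 / (2 * (1 - x))) * (-1)) (at x)"
        using that R'[of "1 - x"] by (intro DERIV_chain2[of R]) (auto intro!: derivative_eq_intros)
      have sq: "((\<lambda>x. (ln x)\<^sup>2 * (ln (1 - x))\<^sup>2 / 4) has_real_derivative
          ln x * (ln (1 - x))\<^sup>2 / (2 * x) - ln (1 - x) * (ln x)\<^sup>2 / (2 * (1 - x))) (at x)"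
      proof -
        \<comment> \<open>Naming the reciprocals makes the derivative a polynomial identity, with no
          division by x or 1 - x to simplify.\<close>
        define r q where "r = 1 / x" and "q = 1 / (1 - x)"
        have L: "(ln has_real_derivative r) (at x)" "((\<lambda>x. ln (1 - x)) has_real_derivative - q) (at x)"
          using that by (auto intro!: derivative_eq_intros simp: r_def q_def)
        have "((\<lambda>x. (ln x)\<^sup>2 * (ln (1 - x))\<^sup>2 / 4) has_real_derivative
            ln x * (ln (1 - x))\<^sup>2 / 2 * r - ln (1 - x) * (ln x)\<^sup>2 / 2 * q) (at x)"
          by (rule DERIV_cong, (rule L DERIV_const DERIV_add DERIV_diff DERIV_mult DERIV_power DERIV_cdivide)+)
             (simp add: algebra_simps power2_eq_square add_divide_distrib diff_divide_distrib)
        then show ?thesis by (simp add: r_def q_def)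
      qed
      show ?thesis unfolding G_def
        by (rule DERIV_cong[OF DERIV_diff[OF DERIV_add[OF R' *] sq]]) (use that in auto)
    qed
    show "continuous_on {1/2..<1} G"
    proof -
      have "continuous_on {0<..<1} R"
        using R' by (intro DERIV_continuous_on) (auto intro: has_field_derivative_at_within)
      then have "continuous_on {1/2..<1} R" "continuous_on {1/2..<1} (\<lambda>x. R (1 - x))"
        by (rule continuous_on_subset, force, rule continuous_on_compose2)
          (auto intro!: continuous_intros)
      then show ?thesis unfolding G_def by (intro continuous_intros) auto
    qed
    have 1: "((\<lambda>x. ln x * ?s 2 x - ?s 3 x) \<longlongrightarrow> ln 1 * ?s 2 1 - ?s 3 1) (at_left 1)"
      by (intro tendsto_diff tendsto_mult tendsto_ln tendsto_gpolylog_compose summable_harm tendsto_ident_at)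
         (auto simp: eventually_at_left_field intro: exI[of _ 0])
    have "filterlim (\<lambda>x::real. 1 - x) (at_right 0) (at_left 1)" by real_asymp
    then have 2: "((\<lambda>x. ln (1 - x) * ?s 2 (1 - x) - ?s 3 (1 - x)) \<longlongrightarrow> 0 - ?s 3 0) (at_left 1)"
      by (intro tendsto_diff tendsto_gpolylog_compose summable_harm tendsto_ln_mult_gpolylog_0)
         (auto simp: eventually_at_left_field intro: exI[of _ 0] intro!: tendsto_eq_intros)
    have 3: "((\<lambda>x::real. (ln x)\<^sup>2 * (ln (1 - x))\<^sup>2 / 4) \<longlongrightarrow> 0) (at_left 1)" by real_asymp
    from tendsto_diff[OF tendsto_add[OF 1 2] 3] show "(G \<longlongrightarrow> - ?s 3 1) (at_left 1)"
      by (simp add: G_def R_def)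
  qed simp
  \<comment> \<open>Since 1/2 is fixed by x -> 1 - x, \<open>G (1/2)\<close> contains
    \<open>R (1/2)\<close> twice, whence the halved right-hand side.\<close>
  then show ?thesis
    by (simp add: G_def R_def ln_div power2_eq_square eval_nat_numeral)
qed

text \<open>
  The summands of G arise by integrating ln u (ln (1 + u))^2 / u by parts after the substitution
  u = (1 - x) / x, for which 1 - 1 / x = - u; x = 1/2 and x = 1 correspond to u = 1 and u = 0.
\<close>

lemma gpolylog_harm_3_minus_1:
  "- gpolylog harm 3 (-1) = 2 * polylog 4 1 - lambda_fn 4 (1/2) - gpolylog harm 3 1 / 2"
proof -
  let ?s = "gpolylog harm" and ?l = "gpolylog (\<lambda>_. 1)"
  define G where "G = (\<lambda>x. ((ln (1 - x) - ln x) * ?s 2 (1 - 1 / x) - ?s 3 (1 - 1 / x))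
     + (2 * ?l 4 x - 2 * ln x * ?l 3 x + (ln x)\<^sup>2 * ?l 2 x)
     - ln x ^ 4 / 8 - (ln (1 - x))\<^sup>2 * (ln x)\<^sup>2 / 4 + (ln x * ?s 2 x - ?s 3 x) + ln x ^ 3 * ln (1 - x) / 2)"
  have sl: "summable (\<lambda>j. \<bar>1::real\<bar> / real (Suc j) ^ m)" if "m \<ge> 2" for m
    using summable_inverse_powers[OF that] by simp
  have "G (1/2) = 2 * ?l 4 1 - ?s 3 1"
  proof (rule eq_left_limit_of_zero_derivative[where G = G and a = "1/2" and b = 1])
    fix x :: real assume x: "1/2 < x" "x < 1"
    define a b r q w where "a = ln x" "b = ln (1 - x)" "r = 1 / x" "q = 1 / (1 - x)" "w = 1 - 1 / x"
    note defs = a_b_r_q_w_def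
    have w: "\<bar>w\<bar> < 1" "w \<noteq> 0" using x by (auto simp: defs field_simps abs_if)
    \<comment> \<open>As w = - (1 - x)/x, the logarithmic derivative of w is - 1/(x (1 - x)), and
      partial fractions give -(1/x + 1/(1 - x)).\<close>
    have wr: "(1 / w) * (1 / x\<^sup>2) = - (r + q)"
      using x by (simp add: defs field_simps power2_eq_square)
    have s: "(?s (Suc m) has_real_derivative ?s m y / y) (at y)" if "\<bar>y\<bar> < 1" "y \<noteq> 0" for m y
      using that by (intro has_real_derivative_gpolylog; simp add: harm_le_Suc del: of_nat_Suc)
    have l: "(?l (Suc m) has_real_derivative ?l m x / x) (at x)" for m
      using x by (intro has_real_derivative_gpolylog) auto
    have d: "((\<lambda>x. 1 - 1 / x) has_real_derivative 1 / x\<^sup>2) (at x)"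
      using x by (auto intro!: derivative_eq_intros simp: field_simps power2_eq_square)
    have sw: "((\<lambda>x. ?s (Suc m) (1 - 1 / x)) has_real_derivative - (?s m w * (r + q))) (at x)" for m
    proof (rule DERIV_cong[OF DERIV_chain2[OF s[OF w, unfolded defs(5), of m] d]])
      have "?s m w / w * (1 / x\<^sup>2) = ?s m w * ((1 / w) * (1 / x\<^sup>2))" by simp
      then show "?s m (1 - 1 / x) / (1 - 1 / x) * (1 / x\<^sup>2) = - (?s m w * (r + q))"
        unfolding wr defs(5)[symmetric] by (simp add: algebra_simps)
    qed
    \<comment> \<open>Because 1 - w = 1/x, the order 1 series at w is again a squared logarithm of
      x.\<close>
    have s1: "?s 1 w = a\<^sup>2 / 2" "?s 1 x = b\<^sup>2 / 2" "?l 1 x = - b"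
      using gpolylog_harm_1[OF w(1)] gpolylog_harm_1[of x] gpolylog_1_1[of x] x by (simp_all add: defs ln_div)
    have D: "((\<lambda>x. ?s 2 (1 - 1 / x)) has_real_derivative - (a\<^sup>2 / 2 * (r + q))) (at x)"
      "((\<lambda>x. ?s 3 (1 - 1 / x)) has_real_derivative - (?s 2 w * (r + q))) (at x)"
      "(?s 2 has_real_derivative b\<^sup>2 / 2 * r) (at x)" "(?s 3 has_real_derivative ?s 2 x * r) (at x)"
      "(?l 2 has_real_derivative - b * r) (at x)" "(?l 3 has_real_derivative ?l 2 x * r) (at x)"
      "(?l 4 has_real_derivative ?l 3 x * r) (at x)"
      using sw[of 1] sw[of 2] s[of x 1] s[of x 2] l[of 1] l[of 2] l[of 3] x unfolding s1
      by (simp_all add: eval_nat_numeral defs(3))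
    have L: "(ln has_real_derivative r) (at x)" "((\<lambda>x. ln (1 - x)) has_real_derivative - q) (at x)"
      using x by (auto intro!: derivative_eq_intros simp: defs)
    show "(G has_real_derivative 0) (at x)" unfolding G_def
      by (rule DERIV_cong, (rule D L DERIV_const DERIV_add DERIV_diff DERIV_mult DERIV_power DERIV_cdivide)+)
         (simp add: a_b_r_q_w_def(1,2,5)[symmetric] algebra_simps eval_nat_numeral add_divide_distrib diff_divide_distrib)
  next
    show "continuous_on {1/2..<1} G" unfolding G_def
      by (intro continuous_intros continuous_on_compose2[OF continuous_on_gpolylog] summable_harm sl)
         (auto simp: field_simps)
  next
    have ev: "eventually (\<lambda>x::real. x \<in> {1/2<..<1}) (at_left 1)"
      by (auto simp: eventually_at_left_field intro: exI[of _ "1/2"])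
    have ev': "eventually (\<lambda>x::real. x \<in> {-1..1}) (at_left 1)" "eventually (\<lambda>x::real. 1 - 1 / x \<in> {-1..1}) (at_left 1)"
      using ev by (auto elim!: eventually_mono simp: field_simps)
    have 0: "((\<lambda>x::real. 1 - 1 / x) \<longlongrightarrow> 0) (at_left 1)" by real_asymp
    have "((\<lambda>x. ln ((1 - x) / x) * ?s 2 (1 - 1 / x)) \<longlongrightarrow> 0) (at_left 1)"
    proof (intro tendsto_ln_mult_gpolylog_0 summable_harm)
      show "filterlim (\<lambda>x::real. (1 - x) / x) (at_right 0) (at_left 1)" by real_asymp
      show "\<forall>\<^sub>F x in at_left 1. \<bar>1 - 1 / x\<bar> \<le> \<bar>(1 - x) / x :: real\<bar>"
        using ev by eventually_elim (auto simp: field_simps abs_if)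
    qed simp
    moreover have "eventually (\<lambda>x. ln ((1 - x) / x) * ?s 2 (1 - 1 / x) = (ln (1 - x) - ln x) * ?s 2 (1 - 1 / x)) (at_left 1)"
      using ev by eventually_elim (auto simp: ln_div)
    ultimately have 1: "((\<lambda>x. (ln (1 - x) - ln x) * ?s 2 (1 - 1 / x)) \<longlongrightarrow> 0) (at_left 1)"
      using tendsto_cong by fast
    have 2: "((\<lambda>x::real. (ln (1 - x))\<^sup>2 * (ln x)\<^sup>2 / 4) \<longlongrightarrow> 0) (at_left 1)"
      "((\<lambda>x::real. ln x ^ 3 * ln (1 - x) / 2) \<longlongrightarrow> 0) (at_left 1)" by real_asymp+
    have "(G \<longlongrightarrow> (0 - ?s 3 0) + (2 * ?l 4 1 - 2 * ln 1 * ?l 3 1 + (ln 1)\<^sup>2 * ?l 2 1)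
       - ln 1 ^ 4 / 8 - 0 + (ln 1 * ?s 2 1 - ?s 3 1) + 0) (at_left 1)"
      unfolding G_def
      by (intro 1 2 tendsto_add[OF _ 2(2)] tendsto_intros tendsto_gpolylog_compose 0 ev' summable_harm sl) auto
    then show "(G \<longlongrightarrow> 2 * ?l 4 1 - ?s 3 1) (at_left 1)" by simp
  qed simp
  \<comment> \<open>At x = 1/2 one has 1 - 1/x = -1 and ln (1 - x) - ln x = 0. The 3/8 joins the 1/8
    present in \<open>G\<close> with the 1/4 that completes the polylogarithms to
    \<open>lambda_fn 4 (1/2)\<close>. The powers of ln 2 leave - (ln 2)^4 / 8, which the reflection
    identity cancels.\<close>
  moreover have "G (1/2) = - ?s 3 (-1) + lambda_fn 4 (1/2) - 3 / 8 * ln 2 ^ 4 - ln 2 ^ 4 / 4 + ln 2 ^ 4 / 2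
     + (ln (1/2) * ?s 2 (1/2) - ?s 3 (1/2))"
  proof -
    have "lambda_fn 4 (1/2) = 2 * ?l 4 (1/2) - 2 * ln (1/2) * ?l 3 (1/2) + (ln (1/2))\<^sup>2 * ?l 2 (1/2) + ln 2 ^ 4 / 4"
      by (simp add: lambda_fn_def polylog_eq_gpolylog numeral_2_eq_2 ln_div eval_nat_numeral algebra_simps)
    then show ?thesis
      by (simp add: G_def ln_div eval_nat_numeral)
  qed
  ultimately show ?thesis
    using gpolylog_harm_3_half_reflection by (simp add: polylog_eq_gpolylog)
qed

section \<open>The integral of a (ln (2 sin a))^2\<close>

lemma mult_cos_le_sin:
  assumes "0 \<le> x" "x \<le> pi / 2"
  shows "x * cos x \<le> sin x"
proof -
  have "sin 0 - 0 * cos 0 \<le> sin x - x * cos x"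
    using assms(1)
  proof (rule DERIV_nonneg_imp_nondecreasing)
    fix y assume y: "0 \<le> y" "y \<le> x"
    have "((\<lambda>x. sin x - x * cos x) has_real_derivative y * sin y) (at y)"
      by (auto intro!: derivative_eq_intros)
    moreover have "0 \<le> y * sin y" using y assms by (auto intro!: mult_nonneg_nonneg sin_ge_zero)
    ultimately show "\<exists>D. ((\<lambda>x. sin x - x * cos x) has_real_derivative D) (at y) \<and> 0 \<le> D" by blast
  qed
  then show ?thesis by simp
qed

text \<open>A crude linear bound suffices, to trade the weight a for sin a in a majorant. Halving
  the angle gives a point where the cosine is at least 1/2.\<close>

lemma le_4_sin:
  assumes "0 \<le> x" "x \<le> pi / 2"
  shows "x \<le> 4 * sin x"
proof -
  have c: "1 / 2 \<le> cos (x / 2)"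
    using assms cos_monotone_0_pi_le[of "x / 2" "pi / 3"] by (simp add: cos_60)
  have "x / 2 * (1 / 2) \<le> x / 2 * cos (x / 2)" using assms c by (intro mult_left_mono) auto
  also have "\<dots> \<le> sin (x / 2)" using assms by (intro mult_cos_le_sin) auto
  finally have s: "x / 4 \<le> sin (x / 2)" by simp
  have "x / 4 * (1 / 2) \<le> sin (x / 2) * cos (x / 2)"
    using assms c s by (intro mult_mono) auto
  also have "\<dots> = sin x / 2" using sin_double[of "x / 2"] by simp
  finally show ?thesis by simp
qed

text \<open>- ln s = 2 ln (1 / sqrt s) \<le> 2 / sqrt s, and squaring gives the constant 4.\<close>

lemma mult_ln_square_le:
  fixes s :: real
  assumes "0 < s" "s \<le> 1"
  shows "s * (ln s)\<^sup>2 \<le> 4"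
proof -
  have "ln (1 / sqrt s) \<le> 1 / sqrt s" using assms ln_le_minus_one[of "1 / sqrt s"] by auto
  then have "- ln s \<le> 2 / sqrt s" using assms by (simp add: ln_div ln_sqrt)
  then have "(- ln s)\<^sup>2 \<le> (2 / sqrt s)\<^sup>2" using assms by (intro power_mono) auto
  then show ?thesis using assms by (simp add: field_simps)
qed

text \<open>A lower bound uniform in r. The squared modulus is (1 - r)^2 + 4 r (sin a)^2: for r
  \<ge> 1/4 the second term suffices, otherwise (1 - r)^2 \<ge> 1 - 4 r supplies the missing
  part.\<close>

lemma norm_one_minus_ge_sin:
  assumes "0 < r" "r < 1"
  shows "\<bar>sin a\<bar> \<le> cmod (1 - of_real r * cis (2 * a))"
proof -
  have s: "(sin a)\<^sup>2 \<le> 1" by (simp add: abs_square_le_1)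
  have "(cmod (1 - of_real r * cis (2 * a)))\<^sup>2 = (1 - r * cos (2 * a))\<^sup>2 + (r * sin (2 * a))\<^sup>2"
    by (simp add: cmod_power2)
  also have "\<dots> = 1 - 2 * r * cos (2 * a) + r\<^sup>2 * ((cos (2 * a))\<^sup>2 + (sin (2 * a))\<^sup>2)"
    by (simp add: power2_eq_square algebra_simps del: sin_cos_squared_add sin_cos_squared_add2 sin_cos_squared_add3)
  also have "\<dots> = (1 - r)\<^sup>2 + 4 * r * (sin a)\<^sup>2"
    unfolding sin_cos_squared_add2 unfolding cos_double_sin by (simp add: power2_eq_square algebra_simps)
  also have "(1 - r)\<^sup>2 + 4 * r * (sin a)\<^sup>2 \<ge> (sin a)\<^sup>2"
  proof (cases "4 * r \<ge> 1")
    case True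
    then have "1 * (sin a)\<^sup>2 \<le> 4 * r * (sin a)\<^sup>2" by (intro mult_right_mono) auto
    then show ?thesis by (smt (verit) zero_le_power2)
  next
    case False
    then have "(1 - 4 * r) * (sin a)\<^sup>2 \<le> (1 - 4 * r) * 1" using s by (intro mult_left_mono) auto
    moreover have "1 - 4 * r \<le> (1 - r)\<^sup>2" using assms by (simp add: power2_eq_square algebra_simps)
    ultimately show ?thesis by (simp add: algebra_simps)
  qed
  finally show ?thesis by (simp add: power2_le_iff_abs_le)
qed

text \<open>1 - e^(2ia) = 2 sin a e^(i (a - pi/2)), and this argument lies in (-pi/2, 0], well
  inside the principal strip.\<close>

lemma Ln_one_minus_cis:
  assumes "0 < a" "a \<le> pi / 2"
  shows "Ln (1 - cis (2 * a)) = Complex (ln (2 * sin a)) (a - pi / 2)"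
proof (rule Ln_unique)
  have s: "sin a > 0" using assms by (intro sin_gt_zero) auto
  have "exp (Complex (ln (2 * sin a)) (a - pi / 2)) = of_real (2 * sin a) * cis (a - pi / 2)"
    using s by (simp add: exp_eq_polar)
  also have "\<dots> = 1 - cis (2 * a)"
    by (simp add: complex_eq_iff cos_diff sin_diff cos_double_sin sin_double power2_eq_square)
  finally show "exp (Complex (ln (2 * sin a)) (a - pi / 2)) = 1 - cis (2 * a)" .
qed (use assms in auto)

text \<open>The value is 0 for even n and - 1/(2 n^2) for odd n; this is why the sum U runs over odd
  indices.\<close>

lemma integral_mult_cos:
  fixes n :: nat
  assumes "n > 0"
  shows "has_bochner_integral lborel (\<lambda>a. (a * cos (2 * real n * a)) * indicator {0..pi / 2} a)
           (((-1) ^ n - 1) / (4 * real n ^ 2))"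
proof -
  define F where "F = (\<lambda>a. a * sin (2 * real n * a) / (2 * real n) + cos (2 * real n * a) / (4 * real n ^ 2))"
  have "has_bochner_integral lborel (\<lambda>a. (a * cos (2 * real n * a)) * indicator {0..pi / 2} a) (F (pi / 2) - F 0)"
  proof (rule has_bochner_integral_FTC_Icc_real)
    fix a
    show "(F has_real_derivative a * cos (2 * real n * a)) (at a)"
      unfolding F_def using assms
      by (auto intro!: derivative_eq_intros simp: field_simps power2_eq_square)
    show "isCont (\<lambda>a. a * cos (2 * real n * a)) a" by (intro continuous_intros)
  qed simp
  moreover have "F (pi / 2) - F 0 = ((-1) ^ n - 1) / (4 * real n ^ 2)"
    by (simp add: F_def diff_divide_distrib)
  ultimately show ?thesis by simp
qed

text \<open>
  Integrating inside the disc of radius r keeps the series absolutely convergent; the boundary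
  case follows by dominated convergence as r tends to 1.
\<close>

lemma integral_Re_Ln_square:
  assumes r: "0 < r" "r < 1"
  shows "(\<integral>a. a * Re ((Ln (1 - of_real r * cis (2 * a)))\<^sup>2) * indicator {0..pi / 2} a \<partial>lborel)
    = (gpolylog harm 3 (- r) - gpolylog harm 3 r) / 2"
proof -
  define C where "C = (\<lambda>j. harm j * r ^ Suc j / real (Suc j))"
  define f where "f = (\<lambda>j a. C j * ((a * cos (2 * real (Suc j) * a)) * indicator {0..pi / 2} a))"
  have C_nonneg: "C j \<ge> 0" for j using r by (simp add: C_def harm_nonneg)
  have C_sum: "summable C"
    using summable_gpolylog[of harm r 1] r by (simp add: C_def[abs_def] harm_le_Suc del: of_nat_Suc)
  have f_int: "has_bochner_integral lborel (f j) (C j * (((-1) ^ Suc j - 1) / (4 * real (Suc j) ^ 2)))" for j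
    unfolding f_def by (intro has_bochner_integral_mult_right integral_mult_cos) auto
  have f_le: "norm (f j a) \<le> C j * ((pi / 2) * indicator {0..pi / 2} a)" for j a
  proof -
    have "\<bar>a\<bar> * \<bar>cos (2 * real (Suc j) * a)\<bar> \<le> pi / 2 * 1" if "a \<in> {0..pi / 2}"
      using that by (intro mult_mono) auto
    then have "\<bar>a * cos (2 * real (Suc j) * a)\<bar> * indicator {0..pi / 2} a \<le> (pi / 2) * indicator {0..pi / 2} a"
      by (auto simp: abs_mult indicator_def)
    then have "C j * (\<bar>a * cos (2 * real (Suc j) * a)\<bar> * indicator {0..pi / 2} a) \<le> C j * ((pi / 2) * indicator {0..pi / 2} a)"
      by (intro mult_left_mono C_nonneg)
    then show ?thesis using C_nonneg[of j] by (simp add: f_def abs_mult)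
  qed
  have norm_int: "(\<integral>a. norm (f j a) \<partial>lborel) \<le> C j * (pi / 2 * (pi / 2))" for j
  proof -
    have "(\<integral>a. norm (f j a) \<partial>lborel) \<le> (\<integral>a. C j * ((pi / 2) * indicator {0..pi / 2} a) \<partial>lborel)"
      using f_int[of j] f_le[of j]
      by (intro integral_mono integrable_norm integrable_mult_right)
         (auto simp: has_bochner_integral_iff)
    then show ?thesis by simp
  qed
  have "(\<lambda>j. integral\<^sup>L lborel (f j)) sums (\<integral>a. (\<Sum>j. f j a) \<partial>lborel)"
  proof (rule sums_integral)
    show "integrable lborel (f j)" for j using f_int by (simp add: has_bochner_integral_iff)
    show "AE a in lborel. summable (\<lambda>j. norm (f j a))"
    proof (rule AE_I2)
      fix a :: real
      show "summable (\<lambda>j. norm (f j a))"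
        by (rule summable_comparison_test'[OF summable_mult2[OF C_sum, of "(pi / 2) * indicator {0..pi / 2} a"]])
           (use f_le in \<open>simp del: mult_cancel_left\<close>)
    qed
    show "summable (\<lambda>j. \<integral>a. norm (f j a) \<partial>lborel)"
      by (rule summable_comparison_test'[OF summable_mult2[OF C_sum, of "pi / 2 * (pi / 2)"]])
         (use norm_int in \<open>auto simp: integral_nonneg_AE\<close>)
  qed
  moreover have "(\<Sum>j. f j a) = a * Re ((Ln (1 - of_real r * cis (2 * a)))\<^sup>2) * indicator {0..pi / 2} a / 2" for a
  proof -
    define z where "z = of_real r * cis (2 * a)"
    have z: "norm z < 1" using r by (simp add: z_def norm_mult)
    have "(\<lambda>j. Re (harm j * z ^ Suc j / of_nat (Suc j))) sums Re ((Ln (1 - z))\<^sup>2 / 2)"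
      using harm_powser_sums[OF z Ln_sums[OF z]] by (intro sums_Re) simp
    moreover have "Re (harm j * z ^ Suc j / of_nat (Suc j)) = C j * cos (2 * real (Suc j) * a)" for j
    proof -
      have "harm j * z ^ Suc j / of_nat (Suc j) = of_real (C j) * cis (2 * real (Suc j) * a)"
        by (simp add: z_def C_def power_mult_distrib Complex.DeMoivre of_real_harm mult_ac
            del: of_nat_Suc power_Suc)
      then show ?thesis by simp
    qed
    ultimately have "(\<lambda>j. C j * cos (2 * real (Suc j) * a)) sums (Re ((Ln (1 - z))\<^sup>2) / 2)"
      by simp
    from sums_mult[OF this, of "a * indicator {0..pi / 2} a"]
    have "(\<lambda>j. f j a) sums (a * indicator {0..pi / 2} a * (Re ((Ln (1 - z))\<^sup>2) / 2))"
      by (simp add: f_def mult_ac)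
    then show ?thesis by (simp add: sums_iff z_def mult_ac)
  qed
  ultimately have 1: "(\<lambda>j. C j * (((-1) ^ Suc j - 1) / (4 * real (Suc j) ^ 2))) sums
     ((\<integral>a. a * Re ((Ln (1 - of_real r * cis (2 * a)))\<^sup>2) * indicator {0..pi / 2} a \<partial>lborel) / 2)"
    using f_int by (simp add: has_bochner_integral_iff)
  have "(\<lambda>j. (harm j * (- r) ^ Suc j / real (Suc j) ^ 3 - harm j * r ^ Suc j / real (Suc j) ^ 3) / 4)
    sums ((gpolylog harm 3 (- r) - gpolylog harm 3 r) / 4)"
    unfolding gpolylog_def using r
    by (intro sums_divide sums_diff summable_sums summable_gpolylog) (auto simp: harm_le_Suc simp del: of_nat_Suc)
  moreover have "(harm j * (- r) ^ Suc j / real (Suc j) ^ 3 - harm j * r ^ Suc j / real (Suc j) ^ 3) / 4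
     = C j * (((-1) ^ Suc j - 1) / (4 * real (Suc j) ^ 2))" for j
  proof -
    have e: "(- r) ^ Suc j = (-1) ^ Suc j * r ^ Suc j" by (metis power_minus)
    have "(h * (e * p) / c ^ 3 - h * p / c ^ 3) / 4 = h * p / c * ((e - 1) / (4 * c ^ 2))" if "c > 0" for h e p c :: real
      using that by (simp add: field_simps eval_nat_numeral)
    then show ?thesis unfolding e C_def by (simp del: power_Suc of_nat_Suc) (simp only: mult_ac)
  qed
  ultimately have "(\<lambda>j. C j * (((-1) ^ Suc j - 1) / (4 * real (Suc j) ^ 2)))
    sums ((gpolylog harm 3 (- r) - gpolylog harm 3 r) / 4)" by (simp only:)
  from sums_unique2[OF 1 this] show ?thesis by simp
qed

text \<open>The majorant for r -> 1. One has |Ln w|^2 \<le> 1 + (ln (sin a))^2 + pi^2, and the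
  weight a tames the logarithm at 0. The summands come from a \<le> 4, from a (ln (sin a))^2 \<le> 4
  sin a (ln (sin a))^2 \<le> 16, and from a \<le> 2.\<close>

lemma mult_norm_Ln_square_le:
  assumes "0 < r" "r < 1" "0 \<le> a" "a \<le> pi / 2"
  shows "a * (norm (Ln (1 - of_real r * cis (2 * a))))\<^sup>2 \<le> 4 + 16 + 2 * pi\<^sup>2"
proof (cases "a = 0")
  case False
  define w where "w = 1 - of_real r * cis (2 * a)"
  have s: "0 < sin a" using False assms by (intro sin_gt_zero) auto
  have w: "sin a \<le> cmod w" using norm_one_minus_ge_sin[OF assms(1,2), of a] s by (simp add: w_def)
  have w2: "cmod w \<le> 2"
    unfolding w_def using norm_triangle_ineq4[of 1 "of_real r * cis (2 * a)"] assms by (simp add: norm_mult)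
  have w0: "w \<noteq> 0" using w s by auto
  have "ln (sin a) \<le> ln (cmod w)" "ln (cmod w) \<le> ln 2"
    using w w2 s by (auto intro!: ln_le_cancel_iff[THEN iffD2] intro: less_le_trans)
  moreover have "ln 2 \<le> (1 :: real)" using ln_le_minus_one[of "2::real"] by simp
  ultimately have "\<bar>ln (cmod w)\<bar> \<le> 1 \<or> \<bar>ln (cmod w)\<bar> \<le> \<bar>ln (sin a)\<bar>" by linarith
  then have l: "(ln (cmod w))\<^sup>2 \<le> 1 + (ln (sin a))\<^sup>2"
  proof
    assume "\<bar>ln (cmod w)\<bar> \<le> 1"
    then have "(ln (cmod w))\<^sup>2 \<le> 1" by (simp add: abs_square_le_1)
    then show ?thesis by (smt (verit) zero_le_power2)
  next
    assume "\<bar>ln (cmod w)\<bar> \<le> \<bar>ln (sin a)\<bar>"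
    then have "(ln (cmod w))\<^sup>2 \<le> (ln (sin a))\<^sup>2" by (rule abs_le_square_iff[THEN iffD1])
    then show ?thesis by simp
  qed
  have "\<bar>Im (Ln w)\<bar> \<le> pi" using Im_Ln_le_pi[OF w0] mpi_less_Im_Ln[OF w0] by simp
  then have "(Im (Ln w))\<^sup>2 \<le> pi\<^sup>2" using abs_le_square_iff[of "Im (Ln w)" pi] by simp
  with l have "(norm (Ln w))\<^sup>2 \<le> 1 + (ln (sin a))\<^sup>2 + pi\<^sup>2"
    using w0 by (simp add: cmod_power2)
  then have "a * (norm (Ln w))\<^sup>2 \<le> a * (1 + (ln (sin a))\<^sup>2 + pi\<^sup>2)"
    using assms by (intro mult_left_mono) auto
  also have "\<dots> = a + a * (ln (sin a))\<^sup>2 + a * pi\<^sup>2" by (simp add: algebra_simps)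
  also have "a * (ln (sin a))\<^sup>2 \<le> 4 * sin a * (ln (sin a))\<^sup>2"
    using le_4_sin assms by (intro mult_right_mono) auto
  also have "\<dots> \<le> 16" using mult_ln_square_le[OF s sin_le_one] by simp
  also have "a * pi\<^sup>2 \<le> 2 * pi\<^sup>2" using assms pi_less_4 by (intro mult_right_mono zero_le_power2) linarith
  also have "a \<le> 4" using assms pi_less_4 by linarith
  finally show ?thesis by (simp add: w_def)
qed (simp add: zero_le_power2)

lemma integral_mult_Re_Ln_square_boundary:
  "has_bochner_integral lborel (\<lambda>a. a * ((ln (2 * sin a))\<^sup>2 - (a - pi / 2)\<^sup>2) * indicator {0..pi / 2} a)
     ((gpolylog harm 3 (-1) - gpolylog harm 3 1) / 2)"
proof -
  \<comment> \<open>The shift by 2 makes the first radius 1/2, so all radii lie strictly between 0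
    and 1.\<close>
  define r where "r = (\<lambda>n. 1 - 1 / (real n + 2))"
  have r: "0 < r n" "r n < 1" for n by (auto simp: r_def field_simps)
  have r': "-1 \<le> r n" "r n \<le> 1" for n using r[of n] by auto
  have r_lim: "r \<longlonglongrightarrow> 1" unfolding r_def by real_asymp
  define g where "g = (\<lambda>n a. a * Re ((Ln (1 - of_real (r n) * cis (2 * a)))\<^sup>2) * indicator {0..pi / 2} a)"
  define f where "f = (\<lambda>a. a * ((ln (2 * sin a))\<^sup>2 - (a - pi / 2)\<^sup>2) * indicator {0..pi / 2} a)"
  have meas: "f \<in> borel_measurable lborel" "g n \<in> borel_measurable lborel" for n
  proof -
    show "f \<in> borel_measurable lborel" unfolding f_def by measurable
    have "(\<lambda>a. Ln (1 - of_real (r n) * cis (2 * a))) \<in> borel_measurable borel"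
    proof (intro borel_measurable_continuous_onI continuous_intros)
      fix a :: real
      have "Re (of_real (r n) * cis (2 * a)) \<le> cmod (of_real (r n) * cis (2 * a))" by (rule complex_Re_le_cmod)
      also have "\<dots> < 1" using r[of n] by (simp add: norm_mult)
      finally have "Re (1 - of_real (r n) * cis (2 * a)) > 0" by simp
      then show "1 - of_real (r n) * cis (2 * a) \<notin> \<real>\<^sub>\<le>\<^sub>0"
        by (auto simp: complex_nonpos_Reals_iff)
    qed
    then show "g n \<in> borel_measurable lborel" unfolding g_def by measurable
  qed
  have w: "integrable lborel (\<lambda>a. (4 + 16 + 2 * pi\<^sup>2) * indicator {0..pi / 2} a)" by simp
  \<comment> \<open>At a = 0, where the limiting logarithm is singular, the factor a makes both
    sides 0.\<close>
  have lim: "(\<lambda>n. g n a) \<longlonglongrightarrow> f a" for a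
  proof (cases "0 < a \<and> a \<le> pi / 2")
    case True
    have "1 - cis (2 * a) \<notin> \<real>\<^sub>\<le>\<^sub>0"
    proof -
      have "sin a > 0" using True by (intro sin_gt_zero) auto
      then have "Re (1 - cis (2 * a)) > 0" by (simp add: cos_double_sin)
      then show ?thesis by (auto simp: complex_nonpos_Reals_iff)
    qed
    then have "(\<lambda>n. g n a) \<longlonglongrightarrow> a * Re ((Ln (1 - of_real 1 * cis (2 * a)))\<^sup>2) * indicator {0..pi / 2} a"
      unfolding g_def by (intro tendsto_intros r_lim) auto
    also have "Re ((Ln (1 - of_real 1 * cis (2 * a)))\<^sup>2) = (ln (2 * sin a))\<^sup>2 - (a - pi / 2)\<^sup>2"
      using Ln_one_minus_cis[of a] True by (simp add: power2_eq_square)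
    finally show ?thesis by (simp add: f_def)
  qed (auto simp: f_def g_def indicator_def)
  have bound: "norm (g n a) \<le> (4 + 16 + 2 * pi\<^sup>2) * indicator {0..pi / 2} a" for n a
  proof (cases "a \<in> {0..pi / 2}")
    case True
    have "norm (g n a) \<le> a * norm ((Ln (1 - of_real (r n) * cis (2 * a)))\<^sup>2)"
      using True by (auto simp: g_def abs_mult intro!: mult_left_mono abs_Re_le_cmod)
    then show ?thesis using mult_norm_Ln_square_le[OF r[of n], of a] True by (simp add: norm_power)
  qed (simp add: g_def)
  have "integrable lborel f"
    by (rule integrable_dominated_convergence[where s = g, OF meas w]) (use lim bound in auto)
  moreover have "(\<lambda>n. integral\<^sup>L lborel (g n)) \<longlonglongrightarrow> integral\<^sup>L lborel f"
    by (rule integral_dominated_convergence[where s = g, OF meas w]) (use lim bound in auto)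
  moreover have "(\<lambda>n. integral\<^sup>L lborel (g n)) \<longlonglongrightarrow> (gpolylog harm 3 (-1) - gpolylog harm 3 1) / 2"
  proof -
    have "integral\<^sup>L lborel (g n) = (gpolylog harm 3 (- r n) - gpolylog harm 3 (r n)) / 2" for n
      unfolding g_def by (rule integral_Re_Ln_square[OF r])
    moreover have "(\<lambda>n. (gpolylog harm 3 (- r n) - gpolylog harm 3 (r n)) / 2) \<longlonglongrightarrow> (gpolylog harm 3 (-1) - gpolylog harm 3 1) / 2"
      by (intro tendsto_intros tendsto_gpolylog_compose summable_harm r_lim) (use r' in \<open>auto intro!: always_eventually\<close>)
    ultimately show ?thesis by (simp only:)
  qed
  ultimately show ?thesis
    unfolding f_def[symmetric] has_bochner_integral_iff by (blast intro: LIMSEQ_unique)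
qed

text \<open>The squared argument (a - pi/2)^2, subtracted by taking the real part, is added back;
  its weighted integral is pi^4/192. The remaining term is U, since S(1) - S(-1) retains the odd
  terms twice.\<close>

lemma integral_mult_ln_square_sin:
  "has_bochner_integral lborel (\<lambda>a. a * (ln (2 * sin a))\<^sup>2 * indicator {0..pi / 2} a)
     (pi ^ 4 / 192 - (gpolylog harm 3 1 - gpolylog harm 3 (-1)) / 2)"
proof -
  define F where "F = (\<lambda>a::real. a ^ 4 / 4 - pi * a ^ 3 / 3 + pi\<^sup>2 * a\<^sup>2 / 8)"
  have "has_bochner_integral lborel (\<lambda>a. (a * (a - pi / 2)\<^sup>2) * indicator {0..pi / 2} a) (F (pi / 2) - F 0)"
  proof (rule has_bochner_integral_FTC_Icc_real)
    fix a
    show "(F has_real_derivative a * (a - pi / 2)\<^sup>2) (at a)"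
      unfolding F_def by (auto intro!: derivative_eq_intros simp: field_simps eval_nat_numeral)
    show "isCont (\<lambda>a. a * (a - pi / 2)\<^sup>2) a" by (intro continuous_intros)
  qed simp
  also have "F (pi / 2) - F 0 = pi ^ 4 / 192" by (simp add: F_def power_divide field_simps eval_nat_numeral)
  finally have "has_bochner_integral lborel (\<lambda>a. (a * (a - pi / 2)\<^sup>2) * indicator {0..pi / 2} a) (pi ^ 4 / 192)" .
  from has_bochner_integral_add[OF this integral_mult_Re_Ln_square_boundary] show ?thesis
    by (simp add: algebra_simps diff_divide_distrib)
qed

section \<open>Integrals of ratios of sines\<close>

definition sin_power_integral :: "nat \<Rightarrow> real \<Rightarrow> real" where
  "sin_power_integral n x = integral {0..x} (\<lambda>t. sin t ^ (2 * n))"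

lemma has_integral_sin_power:
  "((\<lambda>t. sin t ^ (2 * n)) has_integral sin_power_integral n x) {0..x}"
  unfolding sin_power_integral_def
  by (intro integrable_integral integrable_continuous_real continuous_intros)

lemma has_real_derivative_sin_power_integral:
  assumes "x > 0"
  shows "(sin_power_integral n has_real_derivative sin x ^ (2 * n)) (at x)"
proof -
  have "((\<lambda>x. integral {0..x} (\<lambda>t. sin t ^ (2 * n))) has_real_derivative sin x ^ (2 * n)) (at x within {0..x + 1})"
    using assms by (intro integral_has_real_derivative continuous_intros) auto
  then show ?thesis
    using assms unfolding sin_power_integral_def[abs_def]
    by (subst (asm) at_within_Icc_at) auto
qed

lemma continuous_on_sin_power_integral: "continuous_on {0..b} (sin_power_integral n)"
  unfolding sin_power_integral_def[abs_def]
  by (intro indefinite_integral_continuous_1 integrable_continuous_real continuous_intros)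

lemma sin_power_integral_nonneg: "0 \<le> sin_power_integral n x"
  by (rule has_integral_nonneg[OF has_integral_sin_power]) auto

text \<open>Against the integrand sin^(2n) cos, which has an explicit primitive: on [0, x] the
  factor cos t lies between cos x and 1.\<close>

lemma sin_power_integral_bounds:
  assumes "0 \<le> x" "x \<le> pi / 2"
  shows "sin x ^ (2 * n + 1) / real (2 * n + 1) \<le> sin_power_integral n x"
    and "cos x * sin_power_integral n x \<le> sin x ^ (2 * n + 1) / real (2 * n + 1)"
proof -
  have "((\<lambda>t. sin t ^ (2 * n) * cos t) has_integral
      (sin x ^ (2 * n + 1) / real (2 * n + 1) - sin 0 ^ (2 * n + 1) / real (2 * n + 1))) {0..x}"
    using assms
    by (intro fundamental_theorem_of_calculus)
       (auto simp flip: has_real_derivative_iff_has_vector_derivative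
          intro!: derivative_eq_intros simp: add_pos_pos simp del: of_nat_Suc of_nat_add of_nat_mult power_Suc)
  then have I: "((\<lambda>t. sin t ^ (2 * n) * cos t) has_integral (sin x ^ (2 * n + 1) / real (2 * n + 1))) {0..x}"
    by simp
  show "sin x ^ (2 * n + 1) / real (2 * n + 1) \<le> sin_power_integral n x"
    by (rule has_integral_le[OF I has_integral_sin_power]) (auto intro: mult_left_le)
  have "((\<lambda>t. cos x * sin t ^ (2 * n)) has_integral (cos x * sin_power_integral n x)) {0..x}"
    by (intro has_integral_mult_right has_integral_sin_power)
  then show "cos x * sin_power_integral n x \<le> sin x ^ (2 * n + 1) / real (2 * n + 1)"
    using assms by (rule_tac has_integral_le[OF _ I])
      (auto simp: mult.commute intro!: mult_right_mono cos_monotone_0_pi_le zero_le_power sin_ge_zero)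
qed

text \<open>The inner integral of (sin t / sin x)^(2n) over 0 < t < x, which each term of the Li_2
  series contributes to J.\<close>

definition sin_ratio :: "nat \<Rightarrow> real \<Rightarrow> real" where
  "sin_ratio n x = sin_power_integral n x / sin x ^ (2 * n)"

lemma has_real_derivative_sin_power_odd:
  "((\<lambda>x. sin x ^ (2 * n + 1)) has_real_derivative (2 * real n + 1) * (cos x * sin x ^ (2 * n))) (at x within A)"
  using DERIV_power[OF has_field_derivative_at_within[OF DERIV_sin], of "2 * n + 1" x A] by (simp add: add.commute)

lemma sin_power_integral_Suc:
  assumes "0 \<le> x"
  shows "2 * real (Suc n) * sin_power_integral (Suc n) x =
    (2 * real n + 1) * sin_power_integral n x - sin x ^ (2 * n + 1) * cos x"
proof -
  have "((\<lambda>t. (2 * real n + 1) * sin t ^ (2 * n) - 2 * real (Suc n) * sin t ^ (2 * Suc n)) has_integral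
      (sin x ^ (2 * n + 1) * cos x - sin 0 ^ (2 * n + 1) * cos 0)) {0..x}"
  proof (intro fundamental_theorem_of_calculus assms)
    fix t
    have "(2 * real n + 1) * (cos t * sin t ^ (2 * n)) * cos t + - sin t * sin t ^ (2 * n + 1) =
       (2 * real n + 1) * sin t ^ (2 * n) * (cos t)\<^sup>2 - sin t ^ (2 * n) * (sin t)\<^sup>2"
      by (simp add: power2_eq_square)
    also have "\<dots> = (2 * real n + 1) * sin t ^ (2 * n) - 2 * real (Suc n) * (sin t ^ (2 * n) * (sin t)\<^sup>2)"
      unfolding cos_squared_eq by (simp add: algebra_simps)
    also have "sin t ^ (2 * n) * (sin t)\<^sup>2 = sin t ^ (2 * Suc n)"
      by (simp flip: power_add)
    finally have eq: "(2 * real n + 1) * (cos t * sin t ^ (2 * n)) * cos t + - sin t * sin t ^ (2 * n + 1) =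
      (2 * real n + 1) * sin t ^ (2 * n) - 2 * real (Suc n) * sin t ^ (2 * Suc n)" .
    have "((\<lambda>t. sin t ^ (2 * n + 1) * cos t) has_real_derivative
       (2 * real n + 1) * sin t ^ (2 * n) - 2 * real (Suc n) * sin t ^ (2 * Suc n)) (at t within {0..x})"
      unfolding eq[symmetric]
      by (intro DERIV_mult has_real_derivative_sin_power_odd has_field_derivative_at_within[OF DERIV_cos])
    then show "((\<lambda>t. sin t ^ (2 * n + 1) * cos t) has_vector_derivative
       (2 * real n + 1) * sin t ^ (2 * n) - 2 * real (Suc n) * sin t ^ (2 * Suc n)) (at t within {0..x})"
      by (simp only: has_real_derivative_iff_has_vector_derivative)
  qed
  moreover have "((\<lambda>t. (2 * real n + 1) * sin t ^ (2 * n) - 2 * real (Suc n) * sin t ^ (2 * Suc n)) has_integral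
      ((2 * real n + 1) * sin_power_integral n x - 2 * real (Suc n) * sin_power_integral (Suc n) x)) {0..x}"
    by (intro has_integral_diff has_integral_mult_right has_integral_sin_power)
  ultimately have "sin x ^ (2 * n + 1) * cos x - sin 0 ^ (2 * n + 1) * cos 0 =
      (2 * real n + 1) * sin_power_integral n x - 2 * real (Suc n) * sin_power_integral (Suc n) x"
    by (rule has_integral_unique)
  then show ?thesis by simp
qed

text \<open>
  Integrated over (0, pi/2), this yields a recursion in n whose inhomogeneous term
  1 / (2 n + 1) is the limit of the left-hand function at 0.
\<close>

lemma sin_ratio_step:
  assumes "0 < x" "x < pi / 2"
  shows "((\<lambda>x. sin_power_integral n x * cos x / sin x ^ (2 * n + 1)) has_real_derivative
     2 * real n * sin_ratio n x - 2 * real (Suc n) * sin_ratio (Suc n) x) (at x)"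
proof -
  define s c p W where "s = sin x" and "c = cos x" and "p = sin x ^ (2 * n)" and "W = sin_power_integral n x"
  have s: "s > 0" unfolding s_def using assms by (intro sin_gt_zero) auto
  have p: "p > 0" using s by (simp add: p_def s_def)
  have "((\<lambda>x. sin_power_integral n x * cos x / sin x ^ (2 * n + 1)) has_real_derivative
     ((p * c + W * - s) * (s * p) - W * c * ((2 * real n + 1) * (c * p))) / (s * p * (s * p))) (at x)"
    by (rule DERIV_cong[OF DERIV_divide[OF DERIV_mult[OF has_real_derivative_sin_power_integral DERIV_cos]
          has_real_derivative_sin_power_odd]])
       (use s assms in \<open>auto simp: s_def c_def p_def W_def\<close>)
  also have "((p * c + W * - s) * (s * p) - W * c * ((2 * real n + 1) * (c * p))) / (s * p * (s * p))
     = c / s - W / p - (2 * real n + 1) * W * c\<^sup>2 / (p * s\<^sup>2)"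
    using s p by (simp add: divide_simps) (simp add: algebra_simps power2_eq_square)
  also have "c\<^sup>2 = 1 - s\<^sup>2" by (simp add: c_def s_def cos_squared_eq)
  also have "c / s - W / p - (2 * real n + 1) * W * (1 - s\<^sup>2) / (p * s\<^sup>2) =
      2 * real n * (W / p) - ((2 * real n + 1) * W - s * p * c) / (p * s\<^sup>2)"
    using s p by (simp add: divide_simps) (simp add: algebra_simps power2_eq_square)
  also have "(2 * real n + 1) * W - s * p * c = 2 * real (Suc n) * sin_power_integral (Suc n) x"
    using sin_power_integral_Suc[of x n] assms by (simp add: W_def s_def p_def c_def)
  also have "p * s\<^sup>2 = sin x ^ (2 * Suc n)" by (simp add: p_def s_def flip: power_add)
  finally show ?thesis by (simp add: sin_ratio_def W_def p_def)
qed

lemma tendsto_sin_power_boundary: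
  "((\<lambda>x. sin_power_integral n x * cos x / sin x ^ (2 * n + 1)) \<longlongrightarrow> 1 / real (2 * n + 1)) (at_right 0)"
proof (rule tendsto_sandwich)
  have ev: "eventually (\<lambda>x::real. x \<in> {0<..<pi/2}) (at_right 0)"
    by (auto simp: eventually_at_right_field intro!: exI[of _ "pi / 2"])
  show "\<forall>\<^sub>F x in at_right 0. sin_power_integral n x * cos x / sin x ^ (2 * n + 1) \<le> 1 / real (2 * n + 1)"
    using ev
  proof eventually_elim
    case (elim x)
    then have "sin x ^ (2 * n + 1) > 0" by (intro zero_less_power sin_gt_zero) auto
    then show ?case using sin_power_integral_bounds(2)[of x n] elim
      by (simp add: divide_le_eq mult.commute del: of_nat_Suc power_Suc)
  qed
  show "\<forall>\<^sub>F x in at_right 0. cos x / real (2 * n + 1) \<le> sin_power_integral n x * cos x / sin x ^ (2 * n + 1)"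
    using ev
  proof eventually_elim
    case (elim x)
    then have s: "sin x ^ (2 * n + 1) > 0" by (intro zero_less_power sin_gt_zero) auto
    have "cos x * (sin x ^ (2 * n + 1) / real (2 * n + 1)) \<le> cos x * sin_power_integral n x"
      using elim by (intro mult_left_mono sin_power_integral_bounds) (auto intro!: cos_ge_zero)
    then show ?case using s
      by (simp add: le_divide_eq mult.commute del: of_nat_Suc power_Suc)
  qed
  have "((\<lambda>x. cos x / real (2 * n + 1)) \<longlongrightarrow> cos 0 / real (2 * n + 1)) (at_right 0)"
    by (intro tendsto_intros) auto
  then show "((\<lambda>x. cos x / real (2 * n + 1)) \<longlongrightarrow> 1 / real (2 * n + 1)) (at_right 0)" by simp
qed simp

lemma has_integral_sin_ratio_step:
  assumes "(sin_ratio n has_integral c) {0..pi / 2}"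
  shows "(sin_ratio (Suc n) has_integral (2 * real n * c + 1 / real (2 * n + 1)) / (2 * real (Suc n))) {0..pi / 2}"
proof -
  \<comment> \<open>The limit is put in at 0 so that \<open>X\<close> is continuous on the closed
    interval; at pi/2 the cosine makes it vanish.\<close>
  define X where "X = (\<lambda>x. if x = 0 then 1 / real (2 * n + 1) else sin_power_integral n x * cos x / sin x ^ (2 * n + 1))"
  have "((\<lambda>x. 2 * real n * sin_ratio n x - 2 * real (Suc n) * sin_ratio (Suc n) x) has_integral (X (pi / 2) - X 0)) {0..pi / 2}"
  proof (rule fundamental_theorem_of_calculus_interior)
    fix x assume "x \<in> {0<..<pi / 2}"
    then have x: "0 < x" "x < pi / 2" by auto
    have "(X has_real_derivative 2 * real n * sin_ratio n x - 2 * real (Suc n) * sin_ratio (Suc n) x) (at x)"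
    proof (rule has_field_derivative_transform_within_open[OF sin_ratio_step[OF x]])
      show "open {0<..<pi / 2}" by simp
    qed (use x in \<open>auto simp: X_def\<close>)
    then show "(X has_vector_derivative 2 * real n * sin_ratio n x - 2 * real (Suc n) * sin_ratio (Suc n) x) (at x)"
      by (simp only: has_real_derivative_iff_has_vector_derivative)
  next
    show "continuous_on {0..pi / 2} X"
    proof (rule continuous_on_eq_continuous_within[THEN iffD2, rule_format])
      fix x assume x: "x \<in> {0..pi / 2}"
      show "continuous (at x within {0..pi / 2}) X"
      proof (cases "x = 0")
        case True
        have "(X \<longlongrightarrow> 1 / real (2 * n + 1)) (at_right 0)"
          by (rule Lim_transform_eventually[OF tendsto_sin_power_boundary])
             (auto simp: X_def eventually_at_filter)
        then show ?thesis unfolding continuous_within True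
          by (simp add: X_def at_within_Icc_at_right)
      next
        case False
        have "continuous_on {0<..pi / 2} (\<lambda>x. sin_power_integral n x * cos x / sin x ^ (2 * n + 1))"
          by (intro continuous_intros continuous_on_subset[OF continuous_on_sin_power_integral[of "pi / 2" n]])
             (auto simp: sin_gt_zero[THEN less_imp_neq, symmetric] pi_gt_zero)
        then have "continuous_on {0<..pi / 2} X"
          by (rule continuous_on_eq) (auto simp: X_def)
        then have "continuous (at x within {0<..pi / 2}) X"
          using x False by (auto simp: continuous_on_eq_continuous_within)
        moreover have "at x within {0<..pi / 2} = at x within {0..pi / 2}"
          by (rule at_within_nhd[of _ "{0<..}"]) (use x False in auto)
        ultimately show ?thesis by (simp add: continuous_within)
      qed
    qed
  qed simp
  moreover have "X (pi / 2) - X 0 = - (1 / real (2 * n + 1))" by (simp add: X_def)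
  ultimately have "((\<lambda>x. 2 * real n * sin_ratio n x - 2 * real (Suc n) * sin_ratio (Suc n) x) has_integral - (1 / real (2 * n + 1))) {0..pi / 2}"
    by simp
  from has_integral_diff[OF has_integral_mult_right[OF assms, of "2 * real n"] this]
  have "((\<lambda>x. 2 * real (Suc n) * sin_ratio (Suc n) x) has_integral (2 * real n * c + 1 / real (2 * n + 1))) {0..pi / 2}"
    by simp
  from has_integral_mult_right[OF this, of "1 / (2 * real (Suc n))"] show ?thesis
    by (simp del: of_nat_Suc)
qed

text \<open>If I_n is the integral of \<open>sin_ratio n\<close>, the recursion says that 2 n I_n
  grows by 1/(2n + 1) at each step, so it accumulates to O_n.\<close>

lemma has_integral_sin_ratio:
  "(sin_ratio (Suc n) has_integral (\<Sum>j<Suc n. 1 / real (2 * j + 1)) / (2 * real (Suc n))) {0..pi / 2}"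
proof (induction n)
  case 0
  \<comment> \<open>The recursion multiplies this integral by 0, so its integrability is enough to
    start.\<close>
  have "(sin_ratio 0 has_integral integral {0..pi / 2} (sin_ratio 0)) {0..pi / 2}"
    unfolding sin_ratio_def[abs_def] using continuous_on_sin_power_integral[of "pi / 2" 0]
    by (intro integrable_integral integrable_continuous_real) simp
  from has_integral_sin_ratio_step[OF this] show ?case by simp
next
  case (Suc n)
  show ?case using has_integral_sin_ratio_step[OF Suc]
    by (simp del: of_nat_Suc of_nat_add of_nat_mult)
qed

section \<open>The mean of the squared logarithm over a circle\<close>

text \<open>Frequencies are integers because the product-to-sum formula below produces differences
  of indices.\<close>

lemma integral_Re_cis:
  fixes k :: int
  shows "has_bochner_integral lborel (\<lambda>t. Re (c * cis (2 * pi * of_int k * t)) * indicator {0..1} t)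
    (if k = 0 then Re c else 0)"
proof -
  define F where "F = (\<lambda>t. if k = 0 then Re c * t else
     (Re c * sin (2 * pi * of_int k * t) + Im c * cos (2 * pi * of_int k * t)) / (2 * pi * of_int k))"
  have "has_bochner_integral lborel (\<lambda>t. Re (c * cis (2 * pi * of_int k * t)) * indicator {0..1} t) (F 1 - F 0)"
  proof (rule has_bochner_integral_FTC_Icc_real)
    fix t
    show "(F has_real_derivative Re (c * cis (2 * pi * of_int k * t))) (at t)"
    proof (cases "k = 0")
      case True
      then show ?thesis by (auto simp: F_def intro!: derivative_eq_intros)
    next
      case False
      then show ?thesis unfolding F_def
        by (auto intro!: derivative_eq_intros simp: divide_simps) (simp add: algebra_simps)
    qed
    show "isCont (\<lambda>t. Re (c * cis (2 * pi * of_int k * t))) t"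
      by (auto intro!: continuous_intros)
  qed simp
  moreover have "sin (2 * pi * of_int k) = 0" "cos (2 * pi * of_int k) = 1"
    using sin_int_2pin[of k] cos_int_2pin[of k] by simp_all
  then have "F 1 - F 0 = (if k = 0 then Re c else 0)"
    by (simp add: F_def)
  ultimately show ?thesis by simp
qed

lemma integral_Re_cis_mult:
  "has_bochner_integral lborel
     (\<lambda>t. Re (c * cis (2 * pi * real m * t)) * Re (d * cis (2 * pi * real n * t)) * indicator {0..1} t)
    ((if m = n then Re (c * cnj d) / 2 else 0) + (if m + n = 0 then Re (c * d) / 2 else 0))"
proof -
  have Re_mult: "Re x * Re y = Re (x * cnj y) / 2 + Re (x * y) / 2" for x y
    by (simp add: field_simps)
  have e: "Re (c * cis (2 * pi * real m * t)) * Re (d * cis (2 * pi * real n * t)) =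
     Re (c * cnj d * cis (2 * pi * of_int (int m - int n) * t)) / 2 +
     Re (c * d * cis (2 * pi * of_int (int m + int n) * t)) / 2" for t
  proof -
    have "c * cis (2 * pi * real m * t) * cnj (d * cis (2 * pi * real n * t)) =
       c * cnj d * (cis (2 * pi * real m * t) * cis (- (2 * pi * real n * t)))"
      by (simp add: cis_cnj mult_ac)
    also have "\<dots> = c * cnj d * cis (2 * pi * of_int (int m - int n) * t)"
      unfolding cis_mult by (simp add: algebra_simps)
    finally have 1: "c * cis (2 * pi * real m * t) * cnj (d * cis (2 * pi * real n * t)) =
      c * cnj d * cis (2 * pi * of_int (int m - int n) * t)" .
    have "c * cis (2 * pi * real m * t) * (d * cis (2 * pi * real n * t)) =
       c * d * (cis (2 * pi * real m * t) * cis (2 * pi * real n * t))"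
      by (simp only: mult_ac)
    also have "\<dots> = c * d * cis (2 * pi * of_int (int m + int n) * t)"
      unfolding cis_mult by (simp add: algebra_simps)
    finally have 2: "c * cis (2 * pi * real m * t) * (d * cis (2 * pi * real n * t)) =
       c * d * cis (2 * pi * of_int (int m + int n) * t)" .
    show ?thesis unfolding Re_mult 1 2 ..
  qed
  have "has_bochner_integral lborel
     (\<lambda>t. Re (c * cnj d * cis (2 * pi * of_int (int m - int n) * t)) * indicator {0..1} t / 2 +
          Re (c * d * cis (2 * pi * of_int (int m + int n) * t)) * indicator {0..1} t / 2)
     ((if int m - int n = 0 then Re (c * cnj d) else 0) / 2 + (if int m + int n = 0 then Re (c * d) else 0) / 2)"
    by (intro has_bochner_integral_add has_bochner_integral_divide integral_Re_cis)
  moreover have "(if int m - int n = 0 then Re (c * cnj d) else 0) / 2 + (if int m + int n = 0 then Re (c * d) else 0) / 2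
    = (if m = n then Re (c * cnj d) / 2 else 0) + (if m + n = 0 then Re (c * d) / 2 else 0)"
    by auto
  moreover have "(x / 2 + y / 2) * i = x * i / 2 + y * i / 2" for x y i :: real
    by (simp only: distrib_right times_divide_eq_left)
  ultimately show ?thesis unfolding e by (simp only:)
qed

text \<open>Parseval for finite sums. The frequencies start at 1, so each new term is orthogonal to
  \<open>A\<close> and to the earlier terms, and its square has mean half the squared modulus of its
  coefficient.\<close>

lemma integral_trig_poly_square:
  "has_bochner_integral lborel
     (\<lambda>t. (A + (\<Sum>j<N. Re (c j * cis (2 * pi * real (Suc j) * t))))\<^sup>2 * indicator {0..1} t)
    (A\<^sup>2 + (\<Sum>j<N. (cmod (c j))\<^sup>2) / 2)"
proof (induction N)
  case 0
  show ?case using integral_Re_cis[of "of_real (A\<^sup>2)" 0] by simp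
next
  case (Suc N)
  define e where "e = (\<lambda>j t. Re (c j * cis (2 * pi * real (Suc j) * t)))"
  let ?I = "indicator {0..1} :: real \<Rightarrow> real"
  have 1: "has_bochner_integral lborel (\<lambda>t. e j t * e N t * ?I t) (if j = N then (cmod (c N))\<^sup>2 / 2 else 0)" for j
    using integral_Re_cis_mult[of "c j" "Suc j" "c N" "Suc N"]
    by (auto simp: e_def complex_mult_cnj cmod_power2 simp del: of_nat_Suc)
  have 2: "has_bochner_integral lborel (\<lambda>t. e N t * ?I t) 0"
    using integral_Re_cis[of "c N" "int (Suc N)"] by (simp add: e_def)
  have IH: "has_bochner_integral lborel (\<lambda>t. (A + (\<Sum>j<N. e j t))\<^sup>2 * ?I t) (A\<^sup>2 + (\<Sum>j<N. (cmod (c j))\<^sup>2) / 2)"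
    unfolding e_def by (rule Suc)
  have "has_bochner_integral lborel
     (\<lambda>t. (A + (\<Sum>j<N. e j t))\<^sup>2 * ?I t + 2 * A * (e N t * ?I t) + 2 * (\<Sum>j<N. e j t * e N t * ?I t) + e N t * e N t * ?I t)
     ((A\<^sup>2 + (\<Sum>j<N. (cmod (c j))\<^sup>2) / 2) + 2 * A * 0 + 2 * (\<Sum>j<N. if j = N then (cmod (c N))\<^sup>2 / 2 else 0)
        + (if N = N then (cmod (c N))\<^sup>2 / 2 else 0))"
    by (intro has_bochner_integral_add has_bochner_integral_mult_right has_bochner_integral_sum IH 1 2)
  moreover have "(\<lambda>t. (A + (\<Sum>j<N. e j t))\<^sup>2 * ?I t + 2 * A * (e N t * ?I t) + 2 * (\<Sum>j<N. e j t * e N t * ?I t) + e N t * e N t * ?I t)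
     = (\<lambda>t. (A + (\<Sum>j<Suc N. e j t))\<^sup>2 * ?I t)"
  proof
    fix t
    have "(\<Sum>j<N. e j t * e N t * ?I t) = (\<Sum>j<N. e j t) * e N t * ?I t"
      by (simp add: sum_distrib_right)
    then show "(A + (\<Sum>j<N. e j t))\<^sup>2 * ?I t + 2 * A * (e N t * ?I t) + 2 * (\<Sum>j<N. e j t * e N t * ?I t) + e N t * e N t * ?I t
       = (A + (\<Sum>j<Suc N. e j t))\<^sup>2 * ?I t"
      by (simp add: power2_eq_square algebra_simps)
  qed
  moreover have "(\<Sum>j<N. if j = N then (cmod (c N))\<^sup>2 / 2 else 0) = 0" by (intro sum.neutral) auto
  ultimately have "has_bochner_integral lborel (\<lambda>t. (A + (\<Sum>j<Suc N. e j t))\<^sup>2 * ?I t)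
      (A\<^sup>2 + (\<Sum>j<Suc N. (cmod (c j))\<^sup>2) / 2)"
    by (simp add: add_divide_distrib add_ac)
  then show ?case unfolding e_def .
qed

text \<open>Parseval in the limit: for |w| < 1 the partial sums are bounded by - ln (1 - |w|)
  uniformly in t, so dominated convergence applies, and |c_j|^2 = |w|^(2(j+1)) / (j+1)^2 sums to the
  dilogarithm.\<close>

lemma integral_ln_square_norm:
  assumes "cmod w < 1"
  shows "has_bochner_integral lborel (\<lambda>t. (A + ln (cmod (1 + w * cis (2 * pi * t))))\<^sup>2 * indicator {0..1} t)
    (A\<^sup>2 + polylog 2 ((cmod w)\<^sup>2) / 2)"
proof -
  define c where "c = (\<lambda>j. - ((- w) ^ Suc j / of_nat (Suc j)))"
  define g where "g = (\<lambda>N t. (A + (\<Sum>j<N. Re (c j * cis (2 * pi * real (Suc j) * t))))\<^sup>2 * indicator {0..1} t)"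
  define f where "f = (\<lambda>t. (A + ln (cmod (1 + w * cis (2 * pi * t))))\<^sup>2 * indicator {0..1} t)"
  define K where "K = (\<Sum>j. cmod w ^ Suc j / real (Suc j))"
  have K: "summable (\<lambda>j. cmod w ^ Suc j / real (Suc j))"
    using ln_sums[of "cmod w"] assms by (simp add: sums_iff)
  have g_int: "has_bochner_integral lborel (g N) (A\<^sup>2 + (\<Sum>j<N. (cmod (c j))\<^sup>2) / 2)" for N
    unfolding g_def by (rule integral_trig_poly_square)
  have lim: "(\<lambda>N. g N t) \<longlonglongrightarrow> f t" for t
  proof -
    define z where "z = - w * cis (2 * pi * t)"
    have z: "cmod z < 1" using assms by (simp add: z_def norm_mult)
    have "(\<lambda>j. Re (- (z ^ Suc j / of_nat (Suc j)))) sums Re (Ln (1 - z))"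
      using sums_minus[OF Ln_sums[OF z]] by (intro sums_Re) simp
    moreover have "- (z ^ Suc j / of_nat (Suc j)) = c j * cis (2 * pi * real (Suc j) * t)" for j
      by (simp only: z_def c_def power_mult_distrib Complex.DeMoivre) (simp add: mult_ac del: of_nat_Suc power_Suc)
    moreover have "1 - z \<noteq> 0" using z by auto
    then have "Re (Ln (1 - z)) = ln (cmod (1 + w * cis (2 * pi * t)))" by (simp add: z_def)
    ultimately have "(\<lambda>j. Re (c j * cis (2 * pi * real (Suc j) * t))) sums ln (cmod (1 + w * cis (2 * pi * t)))"
      by (simp only:)
    then show ?thesis unfolding g_def f_def sums_def by (intro tendsto_intros)
  qed
  have bound: "norm (g N t) \<le> (\<bar>A\<bar> + K)\<^sup>2 * indicator {0..1} t" for N t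
  proof -
    have "\<bar>\<Sum>j<N. Re (c j * cis (2 * pi * real (Suc j) * t))\<bar> \<le> (\<Sum>j<N. cmod w ^ Suc j / real (Suc j))"
    proof (rule order_trans[OF sum_abs sum_mono])
      fix j
      have "\<bar>Re (c j * cis (2 * pi * real (Suc j) * t))\<bar> \<le> cmod (c j * cis (2 * pi * real (Suc j) * t))"
        by (rule abs_Re_le_cmod)
      also have "\<dots> = cmod w ^ Suc j / real (Suc j)"
        by (simp add: c_def norm_mult norm_divide norm_power del: of_nat_Suc)
      finally show "\<bar>Re (c j * cis (2 * pi * real (Suc j) * t))\<bar> \<le> cmod w ^ Suc j / real (Suc j)" .
    qed
    also have "\<dots> \<le> K" unfolding K_def by (intro sum_le_suminf K) auto
    finally have "\<bar>A + (\<Sum>j<N. Re (c j * cis (2 * pi * real (Suc j) * t)))\<bar> \<le> \<bar>\<bar>A\<bar> + K\<bar>" by linarith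
    then have "(A + (\<Sum>j<N. Re (c j * cis (2 * pi * real (Suc j) * t))))\<^sup>2 \<le> (\<bar>A\<bar> + K)\<^sup>2"
      by (rule abs_le_square_iff[THEN iffD1])
    then show ?thesis by (simp add: g_def indicator_def)
  qed
  have meas: "f \<in> borel_measurable lborel" "g N \<in> borel_measurable lborel" for N
  proof -
    show "g N \<in> borel_measurable lborel" using g_int[of N] by (auto simp: has_bochner_integral_iff)
    then show "f \<in> borel_measurable lborel"
      using g_int by (intro borel_measurable_LIMSEQ_real[where u = g, OF lim]) (auto dest: borel_measurable_has_bochner_integral)
  qed
  have wi: "integrable lborel (\<lambda>t::real. (\<bar>A\<bar> + K)\<^sup>2 * indicator {0..1} t)" by simp
  have "integrable lborel f"
    by (rule integrable_dominated_convergence[where s = g, OF meas wi]) (use lim bound in auto)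
  moreover have "(\<lambda>N. integral\<^sup>L lborel (g N)) \<longlonglongrightarrow> integral\<^sup>L lborel f"
    by (rule integral_dominated_convergence[where s = g, OF meas wi]) (use lim bound in auto)
  moreover have "(\<lambda>N. integral\<^sup>L lborel (g N)) \<longlonglongrightarrow> A\<^sup>2 + polylog 2 ((cmod w)\<^sup>2) / 2"
  proof -
    have sq: "\<bar>(cmod w)\<^sup>2\<bar> < 1" using assms by (simp add: abs_square_less_1)
    have "(\<lambda>j. 1 * ((cmod w)\<^sup>2) ^ Suc j / real (Suc j) ^ 2) sums polylog 2 ((cmod w)\<^sup>2)"
      unfolding polylog_eq_gpolylog gpolylog_def using sq by (intro summable_sums summable_gpolylog) auto
    moreover have "1 * ((cmod w)\<^sup>2) ^ Suc j / real (Suc j) ^ 2 = (cmod (c j))\<^sup>2" for j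
    proof -
      have "cmod (c j) = cmod w ^ Suc j / real (Suc j)"
        by (simp add: c_def norm_divide norm_power del: of_nat_Suc power_Suc)
      then show ?thesis
        by (simp only: power_divide power_mult[symmetric] mult.commute mult_1)
    qed
    ultimately have "(\<lambda>N. \<Sum>j<N. (cmod (c j))\<^sup>2) \<longlonglongrightarrow> polylog 2 ((cmod w)\<^sup>2)"
      unfolding sums_def by (simp only:)
    then have "(\<lambda>N. A\<^sup>2 + (\<Sum>j<N. (cmod (c j))\<^sup>2) / 2) \<longlonglongrightarrow> A\<^sup>2 + polylog 2 ((cmod w)\<^sup>2) / 2"
      by (intro tendsto_intros) auto
    moreover have "integral\<^sup>L lborel (g N) = A\<^sup>2 + (\<Sum>j<N. (cmod (c j))\<^sup>2) / 2" for N
      using g_int by (simp add: has_bochner_integral_iff)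
    ultimately show ?thesis by (simp only:)
  qed
  ultimately show ?thesis
    unfolding f_def[symmetric] has_bochner_integral_iff by (blast intro: LIMSEQ_unique)
qed

lemma nn_integral_eq_has_bochner:
  fixes f :: "'a \<Rightarrow> real"
  assumes "has_bochner_integral M f x" "\<And>t. 0 \<le> f t"
  shows "(\<integral>\<^sup>+t. ennreal (f t) \<partial>M) = ennreal x"
  using assms by (subst nn_integral_eq_integral) (auto simp: has_bochner_integral_iff)

lemma nn_integral_ln_square_norm_linear:
  assumes "cmod b < cmod a"
  shows "(\<integral>\<^sup>+t. ennreal ((ln (cmod (a + b * cis (2 * pi * t))))\<^sup>2) * indicator {0..1} t \<partial>lborel)
    = ennreal ((ln (cmod a))\<^sup>2 + polylog 2 ((cmod b / cmod a)\<^sup>2) / 2)"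
proof -
  define w where "w = b / a"
  have a: "a \<noteq> 0" using assms by auto
  have w: "cmod w < 1" using assms a by (simp add: w_def norm_divide)
  have b: "b = a * w" using a by (simp add: w_def)
  have eq: "ln (cmod (a + b * cis (2 * pi * t))) = ln (cmod a) + ln (cmod (1 + w * cis (2 * pi * t)))" for t
  proof -
    have "cmod (w * cis (2 * pi * t)) < 1" using w by (simp add: norm_mult)
    then have "w * cis (2 * pi * t) \<noteq> - 1" using norm_minus_cancel[of "1 :: complex"] norm_one[where 'a = complex]
      by (metis less_irrefl)
    then have "1 + w * cis (2 * pi * t) \<noteq> 0" by (simp add: add_eq_0_iff)
    moreover have "a + b * cis (2 * pi * t) = a * (1 + w * cis (2 * pi * t))"
      by (simp only: b distrib_left mult_1_right mult.assoc)
    ultimately show ?thesis using a by (simp add: norm_mult ln_mult)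
  qed
  have "(\<integral>\<^sup>+t. ennreal ((ln (cmod (a + b * cis (2 * pi * t))))\<^sup>2) * indicator {0..1} t \<partial>lborel)
    = (\<integral>\<^sup>+t. ennreal ((ln (cmod a) + ln (cmod (1 + w * cis (2 * pi * t))))\<^sup>2 * indicator {0..1} t) \<partial>lborel)"
    unfolding eq by (intro nn_integral_cong) (simp split: split_indicator)
  also have "\<dots> = ennreal ((ln (cmod a))\<^sup>2 + polylog 2 ((cmod w)\<^sup>2) / 2)"
    by (rule nn_integral_eq_has_bochner[OF integral_ln_square_norm[OF w]]) simp
  finally show ?thesis by (simp add: w_def norm_divide)
qed

section \<open>Reduction of the integral over the cube\<close>

lemma nn_integral_cong_except:
  fixes f g :: "real \<Rightarrow> ennreal"
  assumes "\<And>t. t \<noteq> p \<Longrightarrow> f t = g t"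
  shows "(\<integral>\<^sup>+t. f t \<partial>lborel) = (\<integral>\<^sup>+t. g t \<partial>lborel)"
  using AE_lborel_singleton[of p] assms by (intro nn_integral_cong_AE) auto

text \<open>The window [s, s + 1) is cut at 1 and its second piece moved back by the period.
  Half-open pieces fit without overlap and miss the closed interval by one point.\<close>

lemma nn_integral_periodic_shift:
  fixes f :: "real \<Rightarrow> ennreal"
  assumes [measurable]: "f \<in> borel_measurable borel"
    and per: "\<And>t. f (t + 1) = f t" and s: "0 \<le> s" "s \<le> 1"
  shows "(\<integral>\<^sup>+t. f (s + t) * indicator {0..1} t \<partial>lborel) = (\<integral>\<^sup>+t. f t * indicator {0..1} t \<partial>lborel)"
proof -
  have "(\<integral>\<^sup>+t. f (s + t) * indicator {0..1} t \<partial>lborel) = (\<integral>\<^sup>+t. f (s + t) * indicator {s..<s + 1} (s + t) \<partial>lborel)"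
    by (intro nn_integral_cong_except[of 1]) (auto split: split_indicator)
  also have "\<dots> = (\<integral>\<^sup>+t. f t * indicator {s..<s + 1} t \<partial>lborel)"
    by (subst (2) nn_integral_real_affine[where c = 1 and t = s]) simp_all
  also have "\<dots> = (\<integral>\<^sup>+t. f t * indicator {s..<1} t + f t * indicator {1..<s + 1} t \<partial>lborel)"
    using s by (intro nn_integral_cong) (auto split: split_indicator)
  also have "\<dots> = (\<integral>\<^sup>+t. f t * indicator {s..<1} t \<partial>lborel) + (\<integral>\<^sup>+t. f t * indicator {1..<s + 1} t \<partial>lborel)"
    by (intro nn_integral_add) auto
  also have "(\<integral>\<^sup>+t. f t * indicator {1..<s + 1} t \<partial>lborel) = (\<integral>\<^sup>+t. f (1 + t) * indicator {1..<s + 1} (1 + t) \<partial>lborel)"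
    by (subst nn_integral_real_affine[where c = 1 and t = 1]) simp_all
  also have "\<dots> = (\<integral>\<^sup>+t. f t * indicator {0..<s} t \<partial>lborel)"
    using per by (intro nn_integral_cong) (auto simp: add.commute split: split_indicator)
  also have "(\<integral>\<^sup>+t. f t * indicator {s..<1} t \<partial>lborel) + (\<integral>\<^sup>+t. f t * indicator {0..<s} t \<partial>lborel) =
     (\<integral>\<^sup>+t. f t * indicator {s..<1} t + f t * indicator {0..<s} t \<partial>lborel)"
    by (intro nn_integral_add[symmetric]) auto
  also have "\<dots> = (\<integral>\<^sup>+t. f t * indicator {0..1} t \<partial>lborel)"
    using s
    by (intro nn_integral_cong_except[of 1]) (auto split: split_indicator)
  finally show ?thesis .
qed

text \<open>The substitution t = 1/2 - a/pi centres the interval at the zero of 1 + e(t), whose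
  modulus becomes 2 |sin a|.\<close>

lemma nn_integral_unit_interval_centered:
  fixes f :: "real \<Rightarrow> ennreal"
  assumes [measurable]: "f \<in> borel_measurable borel"
  shows "(\<integral>\<^sup>+t. f t * indicator {0..1} t \<partial>lborel) =
    ennreal (1 / pi) * (\<integral>\<^sup>+a. f (1 / 2 - a / pi) * indicator {- (pi / 2)..pi / 2} a \<partial>lborel)"
proof -
  have ind: "indicator {0..1} (1 / 2 + - (1 / pi) * a) = (indicator {- (pi / 2)..pi / 2} a :: ennreal)" for a
    by (auto simp: indicator_def field_simps)
  have "(\<integral>\<^sup>+t. f t * indicator {0..1} t \<partial>lborel) =
    ennreal \<bar>- (1 / pi)\<bar> * (\<integral>\<^sup>+a. f (1 / 2 + - (1 / pi) * a) * indicator {0..1} (1 / 2 + - (1 / pi) * a) \<partial>lborel)"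
    by (rule nn_integral_real_affine) auto
  then show ?thesis unfolding ind by simp
qed

lemma nn_integral_even:
  fixes f :: "real \<Rightarrow> ennreal"
  assumes [measurable]: "f \<in> borel_measurable borel" and even: "\<And>a. f (- a) = f a" and c: "c \<ge> 0"
  shows "(\<integral>\<^sup>+a. f a * indicator {- c..c} a \<partial>lborel) = 2 * (\<integral>\<^sup>+a. f a * indicator {0..c} a \<partial>lborel)"
proof -
  have "(\<integral>\<^sup>+a. f a * indicator {- c..c} a \<partial>lborel) = (\<integral>\<^sup>+a. f a * indicator {0..c} a + f a * indicator {- c..0} a \<partial>lborel)"
    using c
    by (intro nn_integral_cong_except[of 0]) (auto split: split_indicator)
  also have "\<dots> = (\<integral>\<^sup>+a. f a * indicator {0..c} a \<partial>lborel) + (\<integral>\<^sup>+a. f a * indicator {- c..0} a \<partial>lborel)"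
    by (intro nn_integral_add) auto
  also have "(\<integral>\<^sup>+a. f a * indicator {- c..0} a \<partial>lborel) = (\<integral>\<^sup>+a. f (- a) * indicator {- c..0} (- a) \<partial>lborel)"
    by (subst nn_integral_real_affine[where c = "-1" and t = 0]) simp_all
  also have "\<dots> = (\<integral>\<^sup>+a. f a * indicator {0..c} a \<partial>lborel)"
    unfolding even by (intro nn_integral_cong) (auto split: split_indicator)
  finally show ?thesis by (simp add: mult_2)
qed

text \<open>
  The mean of (ln |a + b e(t)|)^2 for |a| = x and |b| = y. It is only needed for x and y distinct,
  since equality occurs on a null set.
\<close>

definition step_integral :: "real \<Rightarrow> real \<Rightarrow> ennreal" where
  "step_integral x y = ennreal ((ln (max x y))\<^sup>2 + polylog 2 ((min x y / max x y)\<^sup>2) / 2)"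

lemma step_integral_commute: "step_integral x y = step_integral y x"
  by (simp add: step_integral_def max.commute min.commute)

text \<open>If b dominates, conjugating and multiplying by the unit e(t) replaces a + b e(t) by conj
  b + conj a e(t), of equal modulus, and the previous case applies.\<close>

lemma nn_integral_ln_square_norm_step:
  assumes "cmod a \<noteq> cmod b"
  shows "(\<integral>\<^sup>+t. ennreal ((ln (cmod (a + b * cis (2 * pi * t))))\<^sup>2) * indicator {0..1} t \<partial>lborel)
    = step_integral (cmod a) (cmod b)"
proof (cases "cmod b < cmod a")
  case True
  then show ?thesis
    using nn_integral_ln_square_norm_linear[OF True] by (simp add: step_integral_def)
next
  case False
  have "cmod (a + b * cis (2 * pi * t)) = cmod (cnj b + cnj a * cis (2 * pi * t))" for t
  proof -
    have "cmod (a + b * cis (2 * pi * t)) = cmod (cnj (a + b * cis (2 * pi * t)) * cis (2 * pi * t))"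
      by (simp only: norm_mult complex_mod_cnj norm_cis mult_1_right)
    also have "cnj (a + b * cis (2 * pi * t)) * cis (2 * pi * t) =
        cnj a * cis (2 * pi * t) + cnj b * (cis (- (2 * pi * t)) * cis (2 * pi * t))"
      by (simp add: cis_cnj distrib_right)
    also have "\<dots> = cnj b + cnj a * cis (2 * pi * t)" by (simp add: cis_mult)
    finally show ?thesis .
  qed
  then show ?thesis
    using nn_integral_ln_square_norm_linear[of "cnj a" "cnj b"] False assms
    by (simp add: step_integral_def)
qed

lemma one_plus_cis_centered: "1 + cis (2 * pi * (1 / 2 - a / pi)) = 1 - cis (- (2 * a))"
proof -
  have "cis (2 * pi * (1 / 2 - a / pi)) = cis pi * cis (- (2 * a))"
    unfolding cis_mult by (simp add: right_diff_distrib)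
  then show ?thesis by simp
qed

lemma norm_one_minus_cis: "cmod (1 - cis (- (2 * a))) = 2 * \<bar>sin a\<bar>"
proof -
  have "(cmod (1 - cis (- (2 * a))))\<^sup>2 = (1 - cos (2 * a))\<^sup>2 + (sin (2 * a))\<^sup>2"
    by (simp add: cmod_power2)
  also have "\<dots> = (2 * \<bar>sin a\<bar>)\<^sup>2"
    unfolding power_mult_distrib power2_abs sin_double cos_double_sin power_mult_distrib cos_squared_eq
    by (simp add: power2_eq_square algebra_simps)
  finally show ?thesis by (rule power2_eq_imp_eq) auto
qed

section \<open>Integration of the circle mean over the triangle and the square\<close>

lemma borel_measurable_polylog [measurable]: "polylog m \<in> borel_measurable borel"
  unfolding polylog_def[abs_def] by measurable

lemma borel_measurable_step_integral [measurable (raw)]: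
  assumes [measurable]: "f \<in> borel_measurable M" "g \<in> borel_measurable M"
  shows "(\<lambda>x. step_integral (f x) (g x)) \<in> borel_measurable M"
  unfolding step_integral_def by measurable

lemma ennreal_polylog_2:
  assumes "0 \<le> q" "q < 1"
  shows "ennreal (polylog 2 (q\<^sup>2)) = (\<Sum>n. ennreal (q ^ (2 * Suc n) / real (Suc n) ^ 2))"
proof -
  have q: "\<bar>q\<^sup>2\<bar> < 1" using assms by (simp add: abs_square_less_1)
  have "summable (\<lambda>n. 1 * (q\<^sup>2) ^ Suc n / real (Suc n) ^ 2)"
    using q by (intro summable_gpolylog) auto
  then have "summable (\<lambda>n. q ^ (2 * Suc n) / real (Suc n) ^ 2)"
    by (simp only: power_mult mult_1)
  then have "(\<Sum>n. ennreal (q ^ (2 * Suc n) / real (Suc n) ^ 2)) = ennreal (\<Sum>n. q ^ (2 * Suc n) / real (Suc n) ^ 2)"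
    using assms by (intro suminf_ennreal2) auto
  also have "(\<Sum>n. q ^ (2 * Suc n) / real (Suc n) ^ 2) = polylog 2 (q\<^sup>2)"
    by (simp only: polylog_def power_mult)
  finally show ?thesis ..
qed

lemma polylog_2_nonneg: "0 \<le> q \<Longrightarrow> q < 1 \<Longrightarrow> 0 \<le> polylog 2 (q\<^sup>2)"
  unfolding polylog_eq_gpolylog gpolylog_def
  by (intro suminf_nonneg summable_gpolylog) (auto simp: abs_square_less_1)

text \<open>The terms are nonnegative, so the series may be integrated termwise even though its
  argument approaches 1 as b tends to a. The half-open interval keeps the ratio below 1.\<close>

lemma nn_integral_polylog_sin_ratio:
  assumes a: "0 < a" "a \<le> pi / 2"
  shows "(\<integral>\<^sup>+b. ennreal (polylog 2 ((sin b / sin a)\<^sup>2)) * indicator {0..<a} b \<partial>lborel)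
    = (\<Sum>n. ennreal (sin_ratio (Suc n) a / real (Suc n) ^ 2))"
proof -
  have sa: "0 < sin a" using a by (intro sin_gt_zero) auto
  have q: "0 \<le> sin b / sin a" "sin b / sin a < 1" if "b \<in> {0..<a}" for b
  proof -
    show "0 \<le> sin b / sin a" using that a sa by (intro divide_nonneg_pos sin_ge_zero) auto
    have "sin b < sin a" using that a by (intro sin_monotone_2pi) auto
    then show "sin b / sin a < 1" using sa by simp
  qed
  have "(\<integral>\<^sup>+b. ennreal (polylog 2 ((sin b / sin a)\<^sup>2)) * indicator {0..<a} b \<partial>lborel)
    = (\<integral>\<^sup>+b. (\<Sum>n. ennreal ((sin b / sin a) ^ (2 * Suc n) / real (Suc n) ^ 2 * indicator {0..<a} b)) \<partial>lborel)"
  proof (intro nn_integral_cong)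
    fix b
    show "ennreal (polylog 2 ((sin b / sin a)\<^sup>2)) * indicator {0..<a} b =
      (\<Sum>n. ennreal ((sin b / sin a) ^ (2 * Suc n) / real (Suc n) ^ 2 * indicator {0..<a} b))"
      using ennreal_polylog_2[OF q, of b] by (cases "b \<in> {0..<a}") simp_all
  qed
  also have "\<dots> = (\<Sum>n. \<integral>\<^sup>+b. ennreal ((sin b / sin a) ^ (2 * Suc n) / real (Suc n) ^ 2 * indicator {0..<a} b) \<partial>lborel)"
    by (intro nn_integral_suminf) measurable
  also have "\<dots> = (\<Sum>n. ennreal (sin_ratio (Suc n) a / real (Suc n) ^ 2))"
  proof (intro suminf_cong)
    fix n
    define C where "C = 1 / (sin a ^ (2 * Suc n) * real (Suc n) ^ 2)"
    have "(\<integral>\<^sup>+b. ennreal ((sin b / sin a) ^ (2 * Suc n) / real (Suc n) ^ 2 * indicator {0..<a} b) \<partial>lborel)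
       = (\<integral>\<^sup>+b. ennreal (C * sin b ^ (2 * Suc n)) * indicator {0..a} b \<partial>lborel)"
      by (intro nn_integral_cong_except[of a]) (auto simp: C_def power_divide split: split_indicator)
    also have "\<dots> = ennreal (C * sin_power_integral (Suc n) a)"
    proof (rule nn_integral_has_integral_lebesgue')
      show "0 \<le> C * sin b ^ (2 * Suc n)" for b
        unfolding C_def by (intro mult_nonneg_nonneg divide_nonneg_nonneg) (auto simp: power_mult simp del: power_Suc of_nat_Suc mult_Suc_right)
      show "((\<lambda>b. C * sin b ^ (2 * Suc n)) has_integral C * sin_power_integral (Suc n) a) {0..a}"
        by (intro has_integral_mult_right has_integral_sin_power)
    qed
    also have "C * sin_power_integral (Suc n) a = sin_ratio (Suc n) a / real (Suc n) ^ 2"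
      by (simp add: C_def sin_ratio_def)
    finally show "(\<integral>\<^sup>+b. ennreal ((sin b / sin a) ^ (2 * Suc n) / real (Suc n) ^ 2 * indicator {0..<a} b) \<partial>lborel)
      = ennreal (sin_ratio (Suc n) a / real (Suc n) ^ 2)" .
  qed
  finally show ?thesis .
qed

lemma sin_ratio_nonneg: "0 \<le> sin_ratio n a"
  unfolding sin_ratio_def by (intro divide_nonneg_nonneg sin_power_integral_nonneg) (simp add: power_mult)

text \<open>The indicator confines the claim to an interval on which
  \<open>sin_power_integral\<close> is continuous.\<close>

lemma borel_measurable_sin_ratio:
  "(\<lambda>a. indicator {0..pi / 2} a * sin_ratio n a) \<in> borel_measurable borel"
proof -
  have "(\<lambda>a. indicator {0..pi / 2} a *\<^sub>R sin_power_integral n a) \<in> borel_measurable borel"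
    by (intro borel_measurable_continuous_on_indicator continuous_on_sin_power_integral) auto
  then have [measurable]: "(\<lambda>a. indicator {0..pi / 2} a * sin_power_integral n a) \<in> borel_measurable borel"
    by simp
  have "(\<lambda>a. indicator {0..pi / 2} a * sin_power_integral n a / sin a ^ (2 * n)) \<in> borel_measurable borel"
    by measurable
  then show ?thesis by (simp add: sin_ratio_def)
qed

lemma nn_integral_sin_ratio:
  "(\<integral>\<^sup>+a. ennreal (indicator {0..pi / 2} a * sin_ratio (Suc n) a) \<partial>lborel)
    = ennreal ((\<Sum>j<Suc n. 1 / real (2 * j + 1)) / (2 * real (Suc n)))"
proof -
  have "(\<integral>\<^sup>+a. ennreal (sin_ratio (Suc n) a) * indicator {0..pi / 2} a \<partial>lborel)
    = ennreal ((\<Sum>j<Suc n. 1 / real (2 * j + 1)) / (2 * real (Suc n)))"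
    by (rule nn_integral_has_integral_lebesgue'[OF sin_ratio_nonneg has_integral_sin_ratio])
  moreover have "ennreal (sin_ratio (Suc n) a) * indicator {0..pi / 2} a = ennreal (indicator {0..pi / 2} a * sin_ratio (Suc n) a)" for a
    by (simp split: split_indicator)
  ultimately show ?thesis by (simp only:)
qed

text \<open>The evaluation of J: the weight 1/n^2 meets the integral O_n / (2n), and
  \<open>u\<close> plays the role of U.\<close>

lemma nn_integral_suminf_sin_ratio:
  assumes "(\<lambda>k. harm (2 * k) / real (2 * k + 1) ^ 3) sums u"
  shows "(\<integral>\<^sup>+a. (\<Sum>n. ennreal (sin_ratio (Suc n) a / real (Suc n) ^ 2)) * indicator {0..pi / 2} a \<partial>lborel)
    = ennreal (15 / 4 * zeta31 - 4 * u)"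
proof -
  let ?O = "\<lambda>n. \<Sum>j<Suc n. 1 / real (2 * j + 1)"
  have "(\<integral>\<^sup>+a. (\<Sum>n. ennreal (sin_ratio (Suc n) a / real (Suc n) ^ 2)) * indicator {0..pi / 2} a \<partial>lborel)
    = (\<integral>\<^sup>+a. (\<Sum>n. ennreal (1 / real (Suc n) ^ 2) * ennreal (indicator {0..pi / 2} a * sin_ratio (Suc n) a)) \<partial>lborel)"
  proof (intro nn_integral_cong)
    fix a
    show "(\<Sum>n. ennreal (sin_ratio (Suc n) a / real (Suc n) ^ 2)) * indicator {0..pi / 2} a =
       (\<Sum>n. ennreal (1 / real (Suc n) ^ 2) * ennreal (indicator {0..pi / 2} a * sin_ratio (Suc n) a))"
      by (cases "a \<in> {0..pi / 2}") (simp_all flip: ennreal_mult' del: of_nat_Suc)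
  qed
  also have "\<dots> = (\<Sum>n. \<integral>\<^sup>+a. ennreal (1 / real (Suc n) ^ 2) * ennreal (indicator {0..pi / 2} a * sin_ratio (Suc n) a) \<partial>lborel)"
    using borel_measurable_sin_ratio by (intro nn_integral_suminf) auto
  also have "\<dots> = (\<Sum>n. ennreal (?O n / (2 * real (Suc n) ^ 3)))"
  proof (intro suminf_cong)
    fix n
    have "(\<integral>\<^sup>+a. ennreal (1 / real (Suc n) ^ 2) * ennreal (indicator {0..pi / 2} a * sin_ratio (Suc n) a) \<partial>lborel)
       = ennreal (1 / real (Suc n) ^ 2) * ennreal (?O n / (2 * real (Suc n)))"
      using borel_measurable_sin_ratio by (subst nn_integral_cmult) (auto simp: nn_integral_sin_ratio simp del: of_nat_Suc sum.lessThan_Suc)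
    also have "\<dots> = ennreal (1 / real (Suc n) ^ 2 * (?O n / (2 * real (Suc n))))"
      by (rule ennreal_mult'[symmetric]) auto
    also have "1 / real (Suc n) ^ 2 * (?O n / (2 * real (Suc n))) = ?O n / (2 * real (Suc n) ^ 3)"
      by (simp add: power2_eq_square power3_eq_cube del: of_nat_Suc sum.lessThan_Suc)
    finally show "(\<integral>\<^sup>+a. ennreal (1 / real (Suc n) ^ 2) * ennreal (indicator {0..pi / 2} a * sin_ratio (Suc n) a) \<partial>lborel)
      = ennreal (?O n / (2 * real (Suc n) ^ 3))" .
  qed
  also have "(\<Sum>n. ennreal (?O n / (2 * real (Suc n) ^ 3))) = ennreal (15 / 4 * zeta31 - 4 * u)"
    using even_part_sums[OF assms]
    by (subst suminf_ennreal2) (auto simp: sums_iff intro!: divide_nonneg_nonneg sum_nonneg simp del: sum.lessThan_Suc)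
  finally show ?thesis .
qed

text \<open>For b < a the larger modulus is 2 sin a, so the logarithmic part is constant in b and
  picks up the length a of the interval; this is the origin of the weight a in I.\<close>

lemma nn_integral_step_integral_below:
  assumes a: "0 < a" "a \<le> pi / 2"
  shows "(\<integral>\<^sup>+b. step_integral (2 * sin a) (2 * sin b) * indicator {0..<a} b \<partial>lborel)
    = ennreal (a * (ln (2 * sin a))\<^sup>2) + ennreal (1 / 2) * (\<Sum>n. ennreal (sin_ratio (Suc n) a / real (Suc n) ^ 2))"
proof -
  have sa: "0 < sin a" using a by (intro sin_gt_zero) auto
  have "(\<integral>\<^sup>+b. step_integral (2 * sin a) (2 * sin b) * indicator {0..<a} b \<partial>lborel)
     = (\<integral>\<^sup>+b. ennreal ((ln (2 * sin a))\<^sup>2) * indicator {0..<a} b +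
          ennreal (1 / 2) * (ennreal (polylog 2 ((sin b / sin a)\<^sup>2)) * indicator {0..<a} b) \<partial>lborel)"
  proof (intro nn_integral_cong)
    fix b
    show "step_integral (2 * sin a) (2 * sin b) * indicator {0..<a} b =
      ennreal ((ln (2 * sin a))\<^sup>2) * indicator {0..<a} b +
          ennreal (1 / 2) * (ennreal (polylog 2 ((sin b / sin a)\<^sup>2)) * indicator {0..<a} b)"
    proof (cases "b \<in> {0..<a}")
      case True
      have lt: "sin b < sin a" using True a by (intro sin_monotone_2pi) auto
      have "0 \<le> sin b" using True a by (intro sin_ge_zero) auto
      then have p: "0 \<le> polylog 2 ((sin b / sin a)\<^sup>2)"
        using lt sa by (intro polylog_2_nonneg) auto
      then have "ennreal (1 / 2) * ennreal (polylog 2 ((sin b / sin a)\<^sup>2)) = ennreal (polylog 2 ((sin b / sin a)\<^sup>2) / 2)"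
        by (simp add: ennreal_mult'[symmetric] del: ennreal_half)
      moreover have "max (2 * sin a) (2 * sin b) = 2 * sin a" "min (2 * sin a) (2 * sin b) = 2 * sin b"
        using lt by auto
      ultimately show ?thesis
        using True p by (simp add: step_integral_def)
    qed simp
  qed
  also have "\<dots> = ennreal ((ln (2 * sin a))\<^sup>2) * ennreal a +
     ennreal (1 / 2) * (\<integral>\<^sup>+b. ennreal (polylog 2 ((sin b / sin a)\<^sup>2)) * indicator {0..<a} b \<partial>lborel)"
    using a by (subst nn_integral_add) (auto simp: nn_integral_cmult)
  also have "ennreal ((ln (2 * sin a))\<^sup>2) * ennreal a = ennreal (a * (ln (2 * sin a))\<^sup>2)"
    using a by (simp add: ennreal_mult'[symmetric] mult.commute)
  finally show ?thesis unfolding nn_integral_polylog_sin_ratio[OF a] .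
qed

lemma nn_integral_step_integral_triangle:
  assumes "(\<lambda>k. harm (2 * k) / real (2 * k + 1) ^ 3) sums u"
  shows "(\<integral>\<^sup>+a. (\<integral>\<^sup>+b. step_integral (2 * sin a) (2 * sin b) * indicator {0..<a} b \<partial>lborel) * indicator {0..pi / 2} a \<partial>lborel)
    = ennreal (pi ^ 4 / 192 - (gpolylog harm 3 1 - gpolylog harm 3 (-1)) / 2) + ennreal (1 / 2) * ennreal (15 / 4 * zeta31 - 4 * u)"
proof -
  have [measurable]: "(\<lambda>a. (\<Sum>n. ennreal (sin_ratio (Suc n) a / real (Suc n) ^ 2)) * indicator {0..pi / 2} a) \<in> borel_measurable borel"
  proof -
    have [measurable]: "(\<lambda>a. indicator {0..pi / 2} a * sin_ratio (Suc n) a) \<in> borel_measurable borel" for n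
      by (rule borel_measurable_sin_ratio)
    have "(\<lambda>a. \<Sum>n. ennreal (indicator {0..pi / 2} a * sin_ratio (Suc n) a / real (Suc n) ^ 2)) \<in> borel_measurable borel"
      by measurable
    also have "(\<lambda>a. \<Sum>n. ennreal (indicator {0..pi / 2} a * sin_ratio (Suc n) a / real (Suc n) ^ 2)) =
       (\<lambda>a. (\<Sum>n. ennreal (sin_ratio (Suc n) a / real (Suc n) ^ 2)) * indicator {0..pi / 2} a)"
      by (auto simp: fun_eq_iff split: split_indicator)
    finally show ?thesis .
  qed
  have "(\<integral>\<^sup>+a. (\<integral>\<^sup>+b. step_integral (2 * sin a) (2 * sin b) * indicator {0..<a} b \<partial>lborel) * indicator {0..pi / 2} a \<partial>lborel)
    = (\<integral>\<^sup>+a. ennreal (a * (ln (2 * sin a))\<^sup>2 * indicator {0..pi / 2} a) +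
        ennreal (1 / 2) * ((\<Sum>n. ennreal (sin_ratio (Suc n) a / real (Suc n) ^ 2)) * indicator {0..pi / 2} a) \<partial>lborel)"
  proof (intro nn_integral_cong_except[of 0])
    fix a :: real assume "a \<noteq> 0"
    then show "(\<integral>\<^sup>+b. step_integral (2 * sin a) (2 * sin b) * indicator {0..<a} b \<partial>lborel) * indicator {0..pi / 2} a =
      ennreal (a * (ln (2 * sin a))\<^sup>2 * indicator {0..pi / 2} a) +
        ennreal (1 / 2) * ((\<Sum>n. ennreal (sin_ratio (Suc n) a / real (Suc n) ^ 2)) * indicator {0..pi / 2} a)"
      using nn_integral_step_integral_below[of a] by (cases "a \<in> {0..pi / 2}") simp_all
  qed
  also have "\<dots> = (\<integral>\<^sup>+a. ennreal (a * (ln (2 * sin a))\<^sup>2 * indicator {0..pi / 2} a) \<partial>lborel) +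
    ennreal (1 / 2) * (\<integral>\<^sup>+a. (\<Sum>n. ennreal (sin_ratio (Suc n) a / real (Suc n) ^ 2)) * indicator {0..pi / 2} a \<partial>lborel)"
    by (subst nn_integral_add, measurable, subst nn_integral_cmult, measurable)
  also have "(\<integral>\<^sup>+a. ennreal (a * (ln (2 * sin a))\<^sup>2 * indicator {0..pi / 2} a) \<partial>lborel) =
      ennreal (pi ^ 4 / 192 - (gpolylog harm 3 1 - gpolylog harm 3 (-1)) / 2)"
    by (rule nn_integral_eq_has_bochner[OF integral_mult_ln_square_sin]) (simp split: split_indicator)
  finally show ?thesis unfolding nn_integral_suminf_sin_ratio[OF assms] .
qed

text \<open>The square is the triangle b < a and its mirror image, apart from the diagonal, which
  meets each section in one point. \<open>T\<close> extends the triangle integrand by 0 so that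
  Tonelli can exchange the variables.\<close>

lemma nn_integral_step_integral_square:
  "(\<integral>\<^sup>+a. (\<integral>\<^sup>+b. step_integral (2 * sin a) (2 * sin b) * indicator {0..pi / 2} b \<partial>lborel) * indicator {0..pi / 2} a \<partial>lborel)
   = 2 * (\<integral>\<^sup>+a. (\<integral>\<^sup>+b. step_integral (2 * sin a) (2 * sin b) * indicator {0..<a} b \<partial>lborel) * indicator {0..pi / 2} a \<partial>lborel)"
proof -
  let ?S = "\<lambda>a b. step_integral (2 * sin a) (2 * sin b)"
  let ?I = "indicator {0..pi / 2} :: real \<Rightarrow> ennreal"
  define T where "T = (\<lambda>a b. ?S a b * (if b < a then 1 else 0) * ?I a * ?I b)"
  have T12: "(\<lambda>(a, b). T a b) \<in> borel_measurable (lborel \<Otimes>\<^sub>M lborel)"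
    and T21: "(\<lambda>(a, b). T b a) \<in> borel_measurable (lborel \<Otimes>\<^sub>M lborel)"
    unfolding T_def by measurable
  have [measurable]: "T a \<in> borel_measurable lborel" "(\<lambda>b. T b a) \<in> borel_measurable lborel" for a
    unfolding T_def by measurable
  have "(\<integral>\<^sup>+a. (\<integral>\<^sup>+b. ?S a b * ?I b \<partial>lborel) * ?I a \<partial>lborel) = (\<integral>\<^sup>+a. \<integral>\<^sup>+b. ?S a b * ?I b * ?I a \<partial>lborel \<partial>lborel)"
    by (subst nn_integral_multc) measurable
  also have "\<dots> = (\<integral>\<^sup>+a. \<integral>\<^sup>+b. T a b + T b a \<partial>lborel \<partial>lborel)"
  proof (rule nn_integral_cong)
    fix a
    show "(\<integral>\<^sup>+b. ?S a b * ?I b * ?I a \<partial>lborel) = (\<integral>\<^sup>+b. T a b + T b a \<partial>lborel)"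
      by (intro nn_integral_cong_except[of a])
         (auto simp: T_def mult_ac step_integral_commute)
  qed
  also have "\<dots> = (\<integral>\<^sup>+a. \<integral>\<^sup>+b. T a b \<partial>lborel \<partial>lborel) + (\<integral>\<^sup>+a. \<integral>\<^sup>+b. T b a \<partial>lborel \<partial>lborel)"
  proof -
    have "(\<integral>\<^sup>+a. \<integral>\<^sup>+b. T a b + T b a \<partial>lborel \<partial>lborel) =
        (\<integral>\<^sup>+a. (\<integral>\<^sup>+b. T a b \<partial>lborel) + (\<integral>\<^sup>+b. T b a \<partial>lborel) \<partial>lborel)"
      by (rule nn_integral_cong, rule nn_integral_add) measurable
    also have "\<dots> = (\<integral>\<^sup>+a. \<integral>\<^sup>+b. T a b \<partial>lborel \<partial>lborel) + (\<integral>\<^sup>+a. \<integral>\<^sup>+b. T b a \<partial>lborel \<partial>lborel)"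
      using T12 T21 by (intro nn_integral_add lborel.borel_measurable_nn_integral) auto
    finally show ?thesis .
  qed
  also have "(\<integral>\<^sup>+a. \<integral>\<^sup>+b. T b a \<partial>lborel \<partial>lborel) = (\<integral>\<^sup>+a. \<integral>\<^sup>+b. T a b \<partial>lborel \<partial>lborel)"
    using T12 by (rule lborel_pair.Fubini')
  also have "(\<integral>\<^sup>+a. \<integral>\<^sup>+b. T a b \<partial>lborel \<partial>lborel) = (\<integral>\<^sup>+a. (\<integral>\<^sup>+b. ?S a b * indicator {0..<a} b \<partial>lborel) * ?I a \<partial>lborel)"
  proof (rule nn_integral_cong)
    fix a :: real
    have "(\<integral>\<^sup>+b. T a b \<partial>lborel) = (\<integral>\<^sup>+b. ?S a b * indicator {0..<a} b * ?I a \<partial>lborel)"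
      by (intro nn_integral_cong) (auto simp: T_def split: split_indicator)
    also have "\<dots> = (\<integral>\<^sup>+b. ?S a b * indicator {0..<a} b \<partial>lborel) * ?I a"
      by (rule nn_integral_multc) measurable
    finally show "(\<integral>\<^sup>+b. T a b \<partial>lborel) = (\<integral>\<^sup>+b. ?S a b * indicator {0..<a} b \<partial>lborel) * ?I a" .
  qed
  finally show ?thesis by (simp only: mult_2)
qed

section \<open>The mean over y and the passage to centred angles\<close>

lemma nn_integral_cong_except2:
  fixes f g :: "real \<Rightarrow> ennreal"
  assumes "\<And>t. t \<noteq> p \<Longrightarrow> t \<noteq> q \<Longrightarrow> f t = g t"
  shows "(\<integral>\<^sup>+t. f t \<partial>lborel) = (\<integral>\<^sup>+t. g t \<partial>lborel)"
proof -
  have "AE t in lborel. t \<noteq> p \<and> t \<noteq> q"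
    using AE_lborel_singleton[of p] AE_lborel_singleton[of q] by auto
  then show ?thesis using assms by (intro nn_integral_cong_AE) auto
qed

lemma ennreal_mult_2: "ennreal c * 2 = ennreal (c * 2)"
  by (simp add: ennreal_mult'')

text \<open>The mean over y once z = y w is substituted; \<open>s\<close>, \<open>u\<close> and
  \<open>t\<close> are the angles of x, w and y as fractions of a full turn.\<close>

definition circle_mean :: "real \<Rightarrow> real \<Rightarrow> ennreal" where
  "circle_mean s u = (\<integral>\<^sup>+t. ennreal ((ln (cmod ((1 + cis (2 * pi * s)) + (1 + cis (2 * pi * u)) * cis (2 * pi * t))))\<^sup>2)
      * indicator {0..1} t \<partial>lborel)"

lemma borel_measurable_cis [measurable (raw)]:
  "f \<in> borel_measurable M \<Longrightarrow> (\<lambda>x. cis (f x)) \<in> borel_measurable M"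
  by (rule measurable_compose[of f]) (auto intro!: borel_measurable_continuous_onI continuous_intros)

lemma borel_measurable_circle_mean:
  "(\<lambda>(s, u). circle_mean s u) \<in> borel_measurable (lborel \<Otimes>\<^sub>M lborel)"
  unfolding circle_mean_def by measurable

lemma borel_measurable_circle_mean' [measurable]:
  "(\<lambda>u. circle_mean s u) \<in> borel_measurable borel"
  using measurable_compose[OF measurable_Pair1' borel_measurable_circle_mean, of s] by simp

text \<open>For fixed y, rotating z by the angle of y preserves its mean, and e(t) + e(t + u) = (1 +
  e(u)) e(t).\<close>

lemma nn_integral_circle_mean_shift:
  assumes t: "t \<in> {0..1}"
  shows "(\<integral>\<^sup>+u. ennreal ((ln (cmod (1 + cis (2 * pi * s) + cis (2 * pi * t) + cis (2 * pi * u))))\<^sup>2) * indicator {0..1} u \<partial>lborel)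
    = (\<integral>\<^sup>+u. ennreal ((ln (cmod ((1 + cis (2 * pi * s)) + (1 + cis (2 * pi * u)) * cis (2 * pi * t))))\<^sup>2) * indicator {0..1} u \<partial>lborel)"
proof -
  define f where "f = (\<lambda>u. ennreal ((ln (cmod (1 + cis (2 * pi * s) + cis (2 * pi * t) + cis (2 * pi * u))))\<^sup>2))"
  have "cis (2 * pi * (u + 1)) = cis (2 * pi * u)" for u
  proof -
    have "cis (2 * pi * (u + 1)) = cis (2 * pi * u) * cis (2 * pi)"
      unfolding cis_mult by (simp add: distrib_left)
    then show ?thesis by simp
  qed
  then have "f (u + 1) = f u" for u by (simp only: f_def)
  moreover have "f \<in> borel_measurable borel" unfolding f_def by measurable
  ultimately have "(\<integral>\<^sup>+u. f (t + u) * indicator {0..1} u \<partial>lborel) = (\<integral>\<^sup>+u. f u * indicator {0..1} u \<partial>lborel)"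
    using t by (intro nn_integral_periodic_shift) auto
  moreover have "f (t + u) = ennreal ((ln (cmod ((1 + cis (2 * pi * s)) + (1 + cis (2 * pi * u)) * cis (2 * pi * t))))\<^sup>2)" for u
  proof -
    have "cis (2 * pi * (t + u)) = cis (2 * pi * u) * cis (2 * pi * t)"
      unfolding cis_mult by (simp add: distrib_left add.commute)
    then show ?thesis by (simp add: f_def distrib_right add.assoc)
  qed
  ultimately show ?thesis by (simp only: f_def)
qed

text \<open>The sine is injective on [-pi/2, pi/2], so the moduli 2 |sin a| and 2 |sin b| can agree
  only for b = a or b = -a.\<close>

lemma circle_mean_centered:
  assumes "a \<in> {- (pi / 2)..pi / 2}" "b \<in> {- (pi / 2)..pi / 2}" "b \<noteq> a" "b \<noteq> - a"
  shows "circle_mean (1 / 2 - a / pi) (1 / 2 - b / pi) = step_integral (2 * \<bar>sin a\<bar>) (2 * \<bar>sin b\<bar>)"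
proof -
  have "\<bar>sin a\<bar> \<noteq> \<bar>sin b\<bar>"
  proof
    assume "\<bar>sin a\<bar> = \<bar>sin b\<bar>"
    then have "sin b = sin a \<or> sin b = sin (- a)" by (auto simp: abs_if split: if_splits)
    then have "b = a \<or> b = - a"
      using assms(1,2) sin_inj_pi[of b a] sin_inj_pi[of b "- a"] by auto
    with assms show False by blast
  qed
  then have "cmod (1 - cis (- (2 * a))) \<noteq> cmod (1 - cis (- (2 * b)))"
    unfolding norm_one_minus_cis by simp
  from nn_integral_ln_square_norm_step[OF this] show ?thesis
    unfolding circle_mean_def one_plus_cis_centered norm_one_minus_cis .
qed

text \<open>Each of the two centring substitutions contributes 1/pi and each evenness a factor 2.
  For given a, only the points b = a and b = -a are discarded.\<close>

lemma nn_integral_circle_mean: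
  "(\<integral>\<^sup>+s. (\<integral>\<^sup>+u. circle_mean s u * indicator {0..1} u \<partial>lborel) * indicator {0..1} s \<partial>lborel)
   = ennreal (4 / pi\<^sup>2) * (\<integral>\<^sup>+a. (\<integral>\<^sup>+b. step_integral (2 * sin a) (2 * sin b) * indicator {0..pi / 2} b \<partial>lborel) * indicator {0..pi / 2} a \<partial>lborel)"
proof -
  let ?J = "indicator {- (pi / 2)..pi / 2} :: real \<Rightarrow> ennreal"
  let ?I = "indicator {0..pi / 2} :: real \<Rightarrow> ennreal"
  let ?S = "\<lambda>a b. step_integral (2 * \<bar>sin a\<bar>) (2 * \<bar>sin b\<bar>)"
  define K where "K = (\<lambda>s. \<integral>\<^sup>+u. circle_mean s u * indicator {0..1} u \<partial>lborel)"
  define Q where "Q = (\<lambda>a. \<integral>\<^sup>+b. ?S a b * ?I b \<partial>lborel)"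
  have [measurable]: "K \<in> borel_measurable borel"
  proof -
    have "(\<lambda>(s, u). circle_mean s u * indicator {0..1} u) \<in> borel_measurable (lborel \<Otimes>\<^sub>M lborel)"
      using borel_measurable_circle_mean unfolding split_beta' by measurable
    then have "(\<lambda>s. \<integral>\<^sup>+u. circle_mean s u * indicator {0..1} u \<partial>lborel) \<in> borel_measurable lborel"
      by (rule lborel.borel_measurable_nn_integral)
    then show ?thesis by (simp add: K_def)
  qed
  have S_meas: "(\<lambda>b. ?S a b) \<in> borel_measurable borel" for a
    by measurable
  have Q_meas [measurable]: "Q \<in> borel_measurable borel"
    unfolding Q_def by measurable
  have K: "K (1 / 2 - a / pi) = ennreal (2 / pi) * Q a" if a: "a \<in> {- (pi / 2)..pi / 2}" for a
  proof -
    have "K (1 / 2 - a / pi) = ennreal (1 / pi) * (\<integral>\<^sup>+b. circle_mean (1 / 2 - a / pi) (1 / 2 - b / pi) * ?J b \<partial>lborel)"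
      unfolding K_def by (rule nn_integral_unit_interval_centered) measurable
    also have "(\<integral>\<^sup>+b. circle_mean (1 / 2 - a / pi) (1 / 2 - b / pi) * ?J b \<partial>lborel) = (\<integral>\<^sup>+b. ?S a b * ?J b \<partial>lborel)"
      by (rule nn_integral_cong_except2[of a "- a"]) (use circle_mean_centered[OF a] in \<open>simp split: split_indicator\<close>)
    also have "\<dots> = 2 * Q a"
      unfolding Q_def by (rule nn_integral_even[OF S_meas]) auto
    also have "ennreal (1 / pi) * (2 * Q a) = ennreal (2 / pi) * Q a"
      unfolding mult.assoc[symmetric] ennreal_mult_2 by simp
    finally show ?thesis .
  qed
  have "(\<integral>\<^sup>+s. K s * indicator {0..1} s \<partial>lborel) = ennreal (1 / pi) * (\<integral>\<^sup>+a. K (1 / 2 - a / pi) * ?J a \<partial>lborel)"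
    by (rule nn_integral_unit_interval_centered) measurable
  also have "(\<integral>\<^sup>+a. K (1 / 2 - a / pi) * ?J a \<partial>lborel) = (\<integral>\<^sup>+a. ennreal (2 / pi) * (Q a * ?J a) \<partial>lborel)"
    by (rule nn_integral_cong) (simp add: K mult.assoc split: split_indicator)
  also have "\<dots> = ennreal (2 / pi) * (\<integral>\<^sup>+a. Q a * ?J a \<partial>lborel)"
    by (rule nn_integral_cmult) measurable
  also have "(\<integral>\<^sup>+a. Q a * ?J a \<partial>lborel) = 2 * (\<integral>\<^sup>+a. Q a * ?I a \<partial>lborel)"
    by (rule nn_integral_even[OF Q_meas]) (auto simp: Q_def)
  also have "(\<integral>\<^sup>+a. Q a * ?I a \<partial>lborel) =
     (\<integral>\<^sup>+a. (\<integral>\<^sup>+b. step_integral (2 * sin a) (2 * sin b) * ?I b \<partial>lborel) * ?I a \<partial>lborel)" (is "_ = ?D")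
  proof (rule nn_integral_cong)
    fix a
    have abs_sin: "\<bar>sin c\<bar> = sin c" if "c \<in> {0..pi / 2}" for c :: real
      using that by (auto intro!: abs_of_nonneg sin_ge_zero)
    have "Q a = (\<integral>\<^sup>+b. step_integral (2 * sin a) (2 * sin b) * ?I b \<partial>lborel)" if "a \<in> {0..pi / 2}"
      unfolding Q_def abs_sin[OF that]
      by (rule nn_integral_cong) (auto simp: abs_sin split: split_indicator)
    then show "Q a * ?I a = (\<integral>\<^sup>+b. step_integral (2 * sin a) (2 * sin b) * ?I b \<partial>lborel) * ?I a"
      by (cases "a \<in> {0..pi / 2}") simp_all
  qed
  also have "ennreal (1 / pi) * (ennreal (2 / pi) * (2 * ?D)) = ennreal (4 / pi\<^sup>2) * ?D"
  proof -
    have "ennreal (1 / pi) * (ennreal (2 / pi) * 2) = ennreal (1 / pi * (2 / pi * 2))"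
      unfolding ennreal_mult_2 by (rule ennreal_mult'[symmetric]) simp
    also have "1 / pi * (2 / pi * 2) = 4 / pi\<^sup>2" by (simp add: power2_eq_square)
    finally have "ennreal (1 / pi) * (ennreal (2 / pi) * 2) = ennreal (4 / pi\<^sup>2)" .
    then show ?thesis by (simp only: mult.assoc[symmetric])
  qed
  finally show ?thesis unfolding K_def .
qed

section \<open>Iterated integration over the cube and the closed form\<close>

lemma nn_integral_unit_cube:
  fixes f :: "real \<Rightarrow> real \<Rightarrow> real \<Rightarrow> ennreal"
  assumes f: "(\<lambda>t. f (fst t) (fst (snd t)) (snd (snd t))) \<in> borel_measurable borel"
  shows "(\<integral>\<^sup>+t. f (fst t) (fst (snd t)) (snd (snd t)) * indicator ({0..1} \<times> {0..1} \<times> {0..1}) t \<partial>lborel) =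
    (\<integral>\<^sup>+x. (\<integral>\<^sup>+y. (\<integral>\<^sup>+z. f x y z * indicator {0..1} z \<partial>lborel) * indicator {0..1} y \<partial>lborel) * indicator {0..1} x \<partial>lborel)"
proof -
  define g where "g = (\<lambda>t. f (fst t) (fst (snd t)) (snd (snd t)) * indicator ({0..1} \<times> {0..1} \<times> {0..1}) t)"
  have cube: "{0..1} \<times> {0..1} \<times> {0..1} \<in> sets (borel :: (real \<times> real \<times> real) measure)"
    by (intro borel_closed closed_Times) auto
  have g: "g \<in> borel_measurable borel"
    unfolding g_def using f cube by measurable
  then have g3: "g \<in> borel_measurable (lborel \<Otimes>\<^sub>M lborel)"
    by (simp add: lborel_prod)
  have g2: "(\<lambda>w. g (x, w)) \<in> borel_measurable (lborel \<Otimes>\<^sub>M lborel)" for x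
    using measurable_compose[OF measurable_Pair1' g3, of x] by (simp add: lborel_prod)
  have f1: "(\<lambda>z. f x y z * indicator {0..1} z) \<in> borel_measurable lborel" for x y
    using measurable_compose[OF _ f, of "\<lambda>z. (x, y, z)" borel] by simp
  have g2': "(\<lambda>(y, z). g (x, y, z)) \<in> borel_measurable (lborel \<Otimes>\<^sub>M lborel)" for x
    using g2[of x] by (simp add: split_beta')
  have mid: "(\<integral>\<^sup>+z. g (x, y, z) \<partial>lborel) = (\<integral>\<^sup>+z. f x y z * indicator {0..1} z \<partial>lborel) * indicator {0..1} y * indicator {0..1} x" for x y
  proof -
    have "(\<integral>\<^sup>+z. g (x, y, z) \<partial>lborel) = (\<integral>\<^sup>+z. f x y z * indicator {0..1} z * (indicator {0..1} y * indicator {0..1} x) \<partial>lborel)"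
      by (rule nn_integral_cong) (simp add: g_def indicator_times mult_ac)
    also have "\<dots> = (\<integral>\<^sup>+z. f x y z * indicator {0..1} z \<partial>lborel) * (indicator {0..1} y * indicator {0..1} x)"
      by (rule nn_integral_multc[OF f1])
    finally show ?thesis by (simp only: mult.assoc)
  qed
  have f2: "(\<lambda>y. (\<integral>\<^sup>+z. f x y z * indicator {0..1} z \<partial>lborel) * indicator {0..1} y) \<in> borel_measurable lborel" for x
  proof -
    have "(\<lambda>(y, z). f x y z) \<in> borel_measurable (lborel \<Otimes>\<^sub>M lborel)"
      using measurable_compose[OF _ f, of "\<lambda>w. (x, w)" borel] by (simp add: lborel_prod split_beta')
    then have "(\<lambda>(y, z). f x y z * indicator {0..1} z) \<in> borel_measurable (lborel \<Otimes>\<^sub>M lborel)"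
      unfolding split_beta' by measurable
    from lborel.borel_measurable_nn_integral[OF this] show ?thesis by measurable
  qed
  have "integral\<^sup>N lborel g = integral\<^sup>N (lborel \<Otimes>\<^sub>M lborel) g" by (simp only: lborel_prod)
  also have "\<dots> = (\<integral>\<^sup>+x. \<integral>\<^sup>+w. g (x, w) \<partial>lborel \<partial>lborel)"
    by (rule lborel.nn_integral_fst[OF g3, symmetric])
  also have "\<dots> = (\<integral>\<^sup>+x. \<integral>\<^sup>+w. g (x, w) \<partial>(lborel \<Otimes>\<^sub>M lborel) \<partial>lborel)" by (simp only: lborel_prod)
  also have "\<dots> = (\<integral>\<^sup>+x. \<integral>\<^sup>+y. \<integral>\<^sup>+z. g (x, y, z) \<partial>lborel \<partial>lborel \<partial>lborel)"
    by (simp only: lborel.nn_integral_fst[OF g2, symmetric])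
  also have "\<dots> = (\<integral>\<^sup>+x. (\<integral>\<^sup>+y. (\<integral>\<^sup>+z. f x y z * indicator {0..1} z \<partial>lborel) * indicator {0..1} y \<partial>lborel) * indicator {0..1} x \<partial>lborel)"
    unfolding mid by (simp only: nn_integral_multc[OF f2])
  finally show ?thesis unfolding g_def .
qed

text \<open>The shift rotates z with y fixed, whereas the circle mean averages over y with w fixed;
  between the two, Tonelli exchanges the order of y and w.\<close>

lemma nn_integral_unit_cube_ln_square:
  assumes "(\<lambda>k. harm (2 * k) / real (2 * k + 1) ^ 3) sums u"
  shows "(\<integral>\<^sup>+t. ennreal ((ln (cmod (1 + cis (2 * pi * fst t) + cis (2 * pi * fst (snd t)) + cis (2 * pi * snd (snd t)))))\<^sup>2)
      * indicator ({0..1} \<times> {0..1} \<times> {0..1}) t \<partial>lborel)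
    = ennreal (4 / pi\<^sup>2) * (2 * (ennreal (pi ^ 4 / 192 - (gpolylog harm 3 1 - gpolylog harm 3 (-1)) / 2)
        + ennreal (1 / 2) * ennreal (15 / 4 * zeta31 - 4 * u)))"
proof -
  let ?I = "indicator {0..1} :: real \<Rightarrow> ennreal"
  define f where "f = (\<lambda>x y z. ennreal ((ln (cmod (1 + cis (2 * pi * x) + cis (2 * pi * y) + cis (2 * pi * z))))\<^sup>2))"
  define H where "H = (\<lambda>x y z. ennreal ((ln (cmod ((1 + cis (2 * pi * x)) + (1 + cis (2 * pi * z)) * cis (2 * pi * y))))\<^sup>2))"
  have f: "(\<lambda>t. f (fst t) (fst (snd t)) (snd (snd t))) \<in> borel_measurable borel"
  proof -
    have "(\<lambda>t. f (fst t) (fst (snd t)) (snd (snd t))) \<in> borel_measurable (borel \<Otimes>\<^sub>M borel \<Otimes>\<^sub>M borel)"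
      unfolding f_def by measurable
    then show ?thesis by (simp add: borel_prod)
  qed
  have H: "(\<lambda>(y, z). H x y z * ?I z * ?I y) \<in> borel_measurable (lborel \<Otimes>\<^sub>M lborel)"
    "(\<lambda>z. H x y z * ?I z) \<in> borel_measurable lborel" "(\<lambda>y. H x y z * ?I y) \<in> borel_measurable lborel" for x y z
    unfolding H_def by measurable
  have inner: "(\<integral>\<^sup>+y. (\<integral>\<^sup>+z. f x y z * ?I z \<partial>lborel) * ?I y \<partial>lborel) = (\<integral>\<^sup>+z. circle_mean x z * ?I z \<partial>lborel)" for x
  proof -
    have "(\<integral>\<^sup>+y. (\<integral>\<^sup>+z. f x y z * ?I z \<partial>lborel) * ?I y \<partial>lborel) = (\<integral>\<^sup>+y. (\<integral>\<^sup>+z. H x y z * ?I z \<partial>lborel) * ?I y \<partial>lborel)"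
    proof (rule nn_integral_cong)
      fix y
      show "(\<integral>\<^sup>+z. f x y z * ?I z \<partial>lborel) * ?I y = (\<integral>\<^sup>+z. H x y z * ?I z \<partial>lborel) * ?I y"
      proof (cases "y \<in> {0..1}")
        case True
        then show ?thesis unfolding f_def H_def by (simp only: nn_integral_circle_mean_shift)
      qed simp
    qed
    also have "\<dots> = (\<integral>\<^sup>+y. \<integral>\<^sup>+z. H x y z * ?I z * ?I y \<partial>lborel \<partial>lborel)"
      by (simp only: nn_integral_multc[OF H(2)])
    also have "\<dots> = (\<integral>\<^sup>+z. \<integral>\<^sup>+y. H x y z * ?I z * ?I y \<partial>lborel \<partial>lborel)"
      by (rule lborel_pair.Fubini'[OF H(1), symmetric])
    also have "\<dots> = (\<integral>\<^sup>+z. \<integral>\<^sup>+y. H x y z * ?I y * ?I z \<partial>lborel \<partial>lborel)"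
      by (simp only: mult_ac)
    also have "\<dots> = (\<integral>\<^sup>+z. (\<integral>\<^sup>+y. H x y z * ?I y \<partial>lborel) * ?I z \<partial>lborel)"
      by (simp only: nn_integral_multc[OF H(3)])
    finally show ?thesis unfolding circle_mean_def H_def .
  qed
  have "(\<integral>\<^sup>+t. f (fst t) (fst (snd t)) (snd (snd t)) * indicator ({0..1} \<times> {0..1} \<times> {0..1}) t \<partial>lborel)
     = (\<integral>\<^sup>+x. (\<integral>\<^sup>+y. (\<integral>\<^sup>+z. f x y z * ?I z \<partial>lborel) * ?I y \<partial>lborel) * ?I x \<partial>lborel)"
    by (rule nn_integral_unit_cube[OF f])
  also have "\<dots> = (\<integral>\<^sup>+x. (\<integral>\<^sup>+z. circle_mean x z * ?I z \<partial>lborel) * ?I x \<partial>lborel)"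
    unfolding inner ..
  finally show ?thesis
    unfolding f_def nn_integral_circle_mean nn_integral_step_integral_square nn_integral_step_integral_triangle[OF assms] .
qed

lemma gpolylog_harm_3_1: "gpolylog harm 3 1 = zeta31"
  using has_sum_imp_sums[OF zeta31_harm] by (simp add: gpolylog_def sums_iff)

lemma gpolylog_harm_3_minus_1_sums:
  "(\<lambda>j. (-1) ^ j * (harm j / real (Suc j) ^ 3)) sums (- gpolylog harm 3 (-1))"
proof -
  have "summable (\<lambda>j. harm j * (-1) ^ Suc j / real (Suc j) ^ 3)"
    by (rule summable_comparison_test'[OF summable_harm[of 3]]) (auto simp: abs_mult power_abs simp del: of_nat_Suc)
  then have "(\<lambda>j. - (harm j * (-1) ^ Suc j / real (Suc j) ^ 3)) sums (- gpolylog harm 3 (-1))"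
    unfolding gpolylog_def by (intro sums_minus summable_sums)
  then show ?thesis by (simp add: mult.commute)
qed

theorem theorem4p7:
  shows "higher_mahler3 2 (\<lambda>x y z. 1 + x + y + z)
           = 12 / pi\<^sup>2 * lambda_fn 4 (1/2) - pi\<^sup>2 / 5"
proof -
  \<comment> \<open>\<open>V\<close> is minus the sum of (-1)^n H_(n-1) / n^3; \<open>u\<close>,
    \<open>A\<close> and \<open>B\<close> are U, I and J.\<close>
  define V where "V = - gpolylog harm 3 (-1)"
  define u where "u = (zeta31 + V) / 2"
  define A where "A = pi ^ 4 / 192 - (gpolylog harm 3 1 - gpolylog harm 3 (-1)) / 2"
  define B where "B = 15 / 4 * zeta31 - 4 * u"
  define f where "f = (\<lambda>t :: real \<times> real \<times> real.
     (ln (cmod (1 + cis (2 * pi * fst t) + cis (2 * pi * fst (snd t)) + cis (2 * pi * snd (snd t)))))\<^sup>2 * indicator ({0..1} \<times> {0..1} \<times> {0..1}) t)"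
  have sums: "(\<lambda>k. harm (2 * k) / real (2 * k + 1) ^ 3) sums u"
    unfolding u_def V_def by (rule odd_part_sums[OF gpolylog_harm_3_minus_1_sums])
  \<comment> \<open>Nonnegativity of \<open>A\<close> and \<open>B\<close> is required because
    \<open>ennreal\<close> sends negative reals to 0.\<close>
  have A: "0 \<le> A"
    using integral_mult_ln_square_sin unfolding A_def[symmetric] has_bochner_integral_iff
    by (auto intro!: integral_nonneg_AE split: split_indicator)
  have B: "0 \<le> B"
    unfolding B_def by (rule sums_le[OF _ sums_zero even_part_sums[OF sums]]) (intro divide_nonneg_nonneg sum_nonneg; simp)
  have f_nonneg: "AE t in lborel. 0 \<le> f t" by (simp add: f_def)
  have f_meas: "f \<in> borel_measurable lborel"
  proof -
    have "f \<in> borel_measurable (borel \<Otimes>\<^sub>M borel \<Otimes>\<^sub>M borel)"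
      unfolding f_def by measurable
    then show ?thesis by (simp add: borel_prod)
  qed
  have "(\<integral>\<^sup>+t. ennreal (f t) \<partial>lborel) = (\<integral>\<^sup>+t. ennreal ((ln (cmod (1 + cis (2 * pi * fst t) + cis (2 * pi * fst (snd t)) + cis (2 * pi * snd (snd t)))))\<^sup>2)
      * indicator ({0..1} \<times> {0..1} \<times> {0..1}) t \<partial>lborel)"
    by (rule nn_integral_cong) (simp add: f_def split: split_indicator)
  also have "\<dots> = ennreal (4 / pi\<^sup>2) * (2 * (ennreal A + ennreal (1 / 2) * ennreal B))"
    unfolding A_def B_def by (rule nn_integral_unit_cube_ln_square[OF sums])
  also have "\<dots> = ennreal (4 / pi\<^sup>2 * ((A + 1 / 2 * B) * 2))"
  proof -
    have "ennreal (1 / 2) * ennreal B = ennreal (1 / 2 * B)" by (rule ennreal_mult'[symmetric]) simp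
    moreover have "ennreal A + ennreal (1 / 2 * B) = ennreal (A + 1 / 2 * B)"
      using A B by (intro ennreal_plus[symmetric]) auto
    moreover have "2 * ennreal (A + 1 / 2 * B) = ennreal ((A + 1 / 2 * B) * 2)"
      by (simp only: ennreal_mult_2 mult.commute[of 2])
    moreover have "ennreal (4 / pi\<^sup>2) * ennreal ((A + 1 / 2 * B) * 2) = ennreal (4 / pi\<^sup>2 * ((A + 1 / 2 * B) * 2))"
      by (rule ennreal_mult'[symmetric]) simp
    ultimately show ?thesis by (simp only:)
  qed
  \<comment> \<open>A finite nonnegative integral yields integrability and the Bochner value
    together.\<close>
  finally have "integral\<^sup>L lborel f = 4 / pi\<^sup>2 * ((A + 1 / 2 * B) * 2)"
    by (intro nn_integral_eq_integrable[THEN iffD1, THEN conjunct2, rotated 3] f_meas f_nonneg)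
       (use A B in \<open>auto intro!: mult_nonneg_nonneg\<close>)
  moreover have "higher_mahler3 2 (\<lambda>x y z. 1 + x + y + z) = integral\<^sup>L lborel f"
    unfolding higher_mahler3_def set_lebesgue_integral_def f_def
    by (simp only: real_scaleR_def mult.commute)
  ultimately have "higher_mahler3 2 (\<lambda>x y z. 1 + x + y + z) = (8 * A + 4 * B) / pi\<^sup>2"
    by (simp add: field_simps)
  \<comment> \<open>The left side is pi^4/24 + 3 zeta(3,1) - 12 V. Inserting V, the coefficients of
    pi^4 add up to 1/24 + 9/360 - 24/90 = -1/5.\<close>
  also have "8 * A + 4 * B = 12 * lambda_fn 4 (1/2) - pi ^ 4 / 5"
  proof -
    have p: "polylog 4 1 = pi ^ 4 / 90" using zeta4 by (simp add: polylog_def)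
    have V: "V = 2 * (pi ^ 4 / 90) - lambda_fn 4 (1/2) - (pi ^ 4 / 360) / 2"
      using gpolylog_harm_3_minus_1 unfolding V_def p gpolylog_harm_3_1 zeta31 .
    have A: "A = pi ^ 4 / 192 - (pi ^ 4 / 360 + V) / 2"
      unfolding A_def V_def gpolylog_harm_3_1 zeta31 by (simp only: diff_conv_add_uminus)
    have B: "B = 15 / 4 * (pi ^ 4 / 360) - 2 * (pi ^ 4 / 360 + V)"
      unfolding B_def u_def zeta31 by (simp add: add_divide_distrib)
    show ?thesis unfolding A B V by (simp add: field_simps)
  qed
  also have "(12 * lambda_fn 4 (1/2) - pi ^ 4 / 5) / pi\<^sup>2 = 12 / pi\<^sup>2 * lambda_fn 4 (1/2) - pi\<^sup>2 / 5"
    by (simp add: diff_divide_distrib) (simp add: field_simps eval_nat_numeral)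
  finally show ?thesis .
qed

end
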